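(* Let $p$ be a prime and let $f:\mathbb{Z}_p\times\mathbb{Z}_p\to\mathbb{Z}_p$ be additively inseparable with $\Delta(f)>2$. Let $P$ be a no-signalling box with inputs and outputs in $\mathbb{Z}_p$ that satisfies information causality. For $x,y,j\in\mathbb{Z}_p$ let $$E_{x,y,j}=\sum_{k=0}^{p-1}P(a=k,\,b=k-f(x,y)+j\mid x,y),$$ and let $\nu_j=\min_{x,y\in\mathbb{Z}_p}E_{x,y,j}$. Then: (i) for every integer $1\le N\le p$, with $L=(N-1)2^{\Delta(f)-2}$, and every $c\in\mathbb{Z}_p$, $$\frac1p\sum_{k=0}^{p-1}\omega_p^{ck}\Big(\sum_{j=0}^{p-1}\nu_j\omega_p^{jk}\Big)^{L/2}\Big(\sum_{j=0}^{p-1}\nu_j\omega_p^{-jk}\Big)^{L/2}\le T_p^{-1}\Big(\frac{N-1}{N}\log_2p\Big);$$ (ii) for every $n\ge1$, with $N=p^n$ and $L=n(p-1)2^{\Delta(f)-2}$, and every $c\in\mathbb{Z}_p$, the same inequality holds. Here $\omega_p=e^{2\pi i/p}$.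
   Context: Let $p$ be a prime. All arithmetic on elements of $\mathbb{Z}_p$ is modulo $p$. A box is a conditional probability distribution $P(a,b\mid x,y)$ with $a,b,x,y\in\mathbb{Z}_p$. It is shared by Alice, who supplies $x$ and receives $a$, and Bob, who supplies $y$ and receives $b$. Different copies act independently. $P$ is no-signalling if $\sum_bP(a,b\mid x,y)$ does not depend on $y$ and $\sum_aP(a,b\mid x,y)$ does not depend on $x$. A function $f$ is additively separable if $f(x,y)=g(x)+h(y)$ for some $g,h:\mathbb{Z}_p\to\mathbb{Z}_p$. Otherwise it is additively inseparable. Every $f$ can be written uniquely as $f(x,y)=\sum_{i,j=0}^{p-1}\lambda_{i,j}x^iy^j$. Define $\Delta(f)=\max_{1\le i,j\le p-1}\mathbb{I}_{\lambda_{i,j}\ne0}(i+j)$, the maximal total degree of a monomial with nonzero coefficient divisible by $xy$. $P$ satisfies information causality if, for every $N\ge1$, every protocol of the following form satisfies $\sum_{i=0}^{N-1}I(x_i:b\mid y=i)\le\log_2p$. In the protocol: - Alice receives $\vec x=(x_0,\dots,x_{N-1})$ uniform in $\mathbb{Z}_p^N$, and Bob receives $y$ uniform in $\{0,\dots,N-1\}$, independent of $\vec x$. - They share randomness (independent of the inputs) and finitely many copies of $P$. - Alice's inputs to her ends of the boxes are functions of $\vec x$, the shared randomness, and her previously obtained outputs. - Alice sends a single message $q\in\mathbb{Z}_p$ to Bob, which is a function of $\vec x$, the randomness, and her outputs. - Bob's inputs to his ends of the boxes are functions of $y$, $q$, the shared randomness, and his previously obtained outputs. - Bob finally outputs $b\in\mathbb{Z}_p$.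 Here $I(x_i:b\mid y=i)$ is the Shannon mutual information (in bits) between $x_i$ and $b$ under the distribution conditioned on $y=i$. Let $h(x)=-x\log_2x-(1-x)\log_2(1-x)$ and $T_p(x)=h(x)+(1-x)\log_2(p-1)$. On $[1/p,1]$, $T_p$ decreases strictly from $\log_2p$ to $0$. $T_p^{-1}:[0,\log_2p]\to[1/p,1]$ denotes the inverse of this restriction. *)

theory Defs
  imports "HOL-Probability.Probability"
begin

text \<open>Conventions: Z_p is represented by the natural numbers {0..<p}; all values
  produced by parties are reduced mod p. A box is P a b x y = P(a,b|x,y).\<close>

definition is_box :: "nat \<Rightarrow> (nat \<Rightarrow> nat \<Rightarrow> nat \<Rightarrow> nat \<Rightarrow> real) \<Rightarrow> bool" where
  "is_box p P \<longleftrightarrow>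
     (\<forall>a b x y. a < p \<longrightarrow> b < p \<longrightarrow> x < p \<longrightarrow> y < p \<longrightarrow> P a b x y \<ge> 0) \<and>
     (\<forall>x y. x < p \<longrightarrow> y < p \<longrightarrow> (\<Sum>a<p. \<Sum>b<p. P a b x y) = 1)"

definition no_signalling :: "nat \<Rightarrow> (nat \<Rightarrow> nat \<Rightarrow> nat \<Rightarrow> nat \<Rightarrow> real) \<Rightarrow> bool" where
  "no_signalling p P \<longleftrightarrow>
     (\<forall>a x y y'. a < p \<longrightarrow> x < p \<longrightarrow> y < p \<longrightarrow> y' < p \<longrightarrow>
        (\<Sum>b<p. P a b x y) = (\<Sum>b<p. P a b x y')) \<and>
     (\<forall>b x x' y. b < p \<longrightarrow> x < p \<longrightarrow> x' < p \<longrightarrow> y < p \<longrightarrow>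
        (\<Sum>a<p. P a b x y) = (\<Sum>a<p. P a b x' y))"

definition vecs :: "nat \<Rightarrow> nat \<Rightarrow> (nat \<Rightarrow> nat) set" where
  "vecs n p = PiE {..<n} (\<lambda>_. {..<p})"

definition trunc :: "nat \<Rightarrow> (nat \<Rightarrow> nat) \<Rightarrow> nat \<Rightarrow> nat" where
  "trunc k v = (\<lambda>j. if j < k then v j else 0)"

text \<open>Protocol with N inputs for Alice, m copies of the box (used in the order 0..m-1),
  shared randomness r (a distribution on nat),
  Alice's box inputs A k xvec rho (outputs so far),
  Alice's message Q xvec rho (all her outputs),
  Bob's box inputs B k y q rho (outputs so far),
  Bob's final output D y q rho (all his outputs).
  ic_joint gives the joint distribution Pr(x_i = u, b = v | y = i).\<close>
definition ic_joint ::
  "nat \<Rightarrow> (nat \<Rightarrow> nat \<Rightarrow> nat \<Rightarrow> nat \<Rightarrow> real) \<Rightarrow> nat \<Rightarrow> nat \<Rightarrow>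
   (nat \<Rightarrow> (nat \<Rightarrow> nat) \<Rightarrow> nat \<Rightarrow> (nat \<Rightarrow> nat) \<Rightarrow> nat) \<Rightarrow>
   ((nat \<Rightarrow> nat) \<Rightarrow> nat \<Rightarrow> (nat \<Rightarrow> nat) \<Rightarrow> nat) \<Rightarrow>
   (nat \<Rightarrow> nat \<Rightarrow> nat \<Rightarrow> nat \<Rightarrow> (nat \<Rightarrow> nat) \<Rightarrow> nat) \<Rightarrow>
   (nat \<Rightarrow> nat \<Rightarrow> nat \<Rightarrow> (nat \<Rightarrow> nat) \<Rightarrow> nat) \<Rightarrow>
   nat pmf \<Rightarrow> nat \<Rightarrow> nat \<Rightarrow> nat \<Rightarrow> real" where
  "ic_joint p P N m A Q B D r i u v =
     (1 / real p ^ N) *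
     (\<Sum>xv \<in> {xv \<in> vecs N p. xv i = u}.
        measure_pmf.expectation r (\<lambda>\<rho>.
          \<Sum>av \<in> vecs m p. \<Sum>bv \<in> vecs m p.
            (let q = Q xv \<rho> (trunc m av) mod p in
             if D i q \<rho> (trunc m bv) mod p = v
             then (\<Prod>k<m. P (av k) (bv k) (A k xv \<rho> (trunc k av) mod p)
                                             (B k i q \<rho> (trunc k bv) mod p))
             else 0)))"

definition mutual_info :: "nat \<Rightarrow> (nat \<Rightarrow> nat \<Rightarrow> real) \<Rightarrow> real" where
  "mutual_info p J =
     (\<Sum>u<p. \<Sum>v<p. if J u v > 0
        then J u v * log 2 (J u v / ((\<Sum>v'<p. J u v') * (\<Sum>u'<p. J u' v)))
        else 0)"

definition info_causality :: "nat \<Rightarrow> (nat \<Rightarrow> nat \<Rightarrow> nat \<Rightarrow> nat \<Rightarrow> real) \<Rightarrow> bool" where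
  "info_causality p P \<longleftrightarrow>
     (\<forall>N m A Q B D r. N \<ge> 1 \<longrightarrow>
        (\<Sum>i<N. mutual_info p (ic_joint p P N m A Q B D r i)) \<le> log 2 (real p))"

definition additively_separable :: "nat \<Rightarrow> (nat \<Rightarrow> nat \<Rightarrow> nat) \<Rightarrow> bool" where
  "additively_separable p f \<longleftrightarrow>
     (\<exists>g h :: nat \<Rightarrow> nat. \<forall>x y. x < p \<longrightarrow> y < p \<longrightarrow> f x y = (g x + h y) mod p)"

definition poly_coeffs :: "nat \<Rightarrow> (nat \<Rightarrow> nat \<Rightarrow> nat) \<Rightarrow> nat \<Rightarrow> nat \<Rightarrow> nat" where
  "poly_coeffs p f = (THE lam. (\<forall>i j. lam i j < p \<and> ((i \<ge> p \<or> j \<ge> p) \<longrightarrow> lam i j = 0)) \<and>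
       (\<forall>x y. x < p \<longrightarrow> y < p \<longrightarrow>
          f x y = (\<Sum>i<p. \<Sum>j<p. lam i j * x ^ i * y ^ j) mod p))"

definition Delta :: "nat \<Rightarrow> (nat \<Rightarrow> nat \<Rightarrow> nat) \<Rightarrow> nat" where
  "Delta p f = Max {(if poly_coeffs p f i j \<noteq> 0 then i + j else 0) | i j.
                      1 \<le> i \<and> i \<le> p - 1 \<and> 1 \<le> j \<and> j \<le> p - 1}"

definition bin_entropy :: "real \<Rightarrow> real" where
  "bin_entropy x = - x * log 2 x - (1 - x) * log 2 (1 - x)"

definition Tp :: "nat \<Rightarrow> real \<Rightarrow> real" where
  "Tp p x = bin_entropy x + (1 - x) * log 2 (real p - 1)"

definition Tp_inv :: "nat \<Rightarrow> real \<Rightarrow> real" where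
  "Tp_inv p t = (THE x. 1 / real p \<le> x \<and> x \<le> 1 \<and> Tp p x = t)"

definition E_val :: "nat \<Rightarrow> (nat \<Rightarrow> nat \<Rightarrow> nat \<Rightarrow> nat \<Rightarrow> real) \<Rightarrow> (nat \<Rightarrow> nat \<Rightarrow> nat) \<Rightarrow>
    nat \<Rightarrow> nat \<Rightarrow> nat \<Rightarrow> real" where
  "E_val p P f x y j =
     (\<Sum>k<p. P k (nat ((int k - int (f x y) + int j) mod int p)) x y)"

definition nu :: "nat \<Rightarrow> (nat \<Rightarrow> nat \<Rightarrow> nat \<Rightarrow> nat \<Rightarrow> real) \<Rightarrow> (nat \<Rightarrow> nat \<Rightarrow> nat) \<Rightarrow> nat \<Rightarrow> real" where
  "nu p P f j = Min {E_val p P f x y j | x y. x < p \<and> y < p}"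

definition omega :: "nat \<Rightarrow> complex" where
  "omega p = exp (2 * pi * \<i> / of_nat p)"

definition bound_lhs :: "nat \<Rightarrow> (nat \<Rightarrow> real) \<Rightarrow> nat \<Rightarrow> nat \<Rightarrow> complex" where
  "bound_lhs p \<nu> L c =
     (1 / of_nat p) * (\<Sum>k<p. omega p ^ (c * k)
        * (\<Sum>j<p. of_real (\<nu> j) * omega p ^ (j * k)) ^ (L div 2)
        * (\<Sum>j<p. of_real (\<nu> j) * inverse (omega p) ^ (j * k)) ^ (L div 2))"

end

theory Submission
  imports Defs "HOL-Number_Theory.Number_Theory" "HOL-Real_Asymp.Real_Asymp"
begin

text \<open>
  Choose a monomial \<open>x\<^sup>a\<^sup>+\<^sup>1 y\<^sup>b\<^sup>+\<^sup>1\<close> of \<open>f\<close> with \<open>a + b = \<Delta>(f) - 2\<close>. Taking \<open>a\<close> finite differences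
  in \<open>x\<close> and \<open>b\<close> in \<open>y\<close> turns \<open>f\<close> into a sum \<open>F\<close> of \<open>2\<^bsup>\<Delta>(f)-2\<^esup>\<close> shifted copies of \<open>f\<close>, half of them
  with sign \<open>-1\<close>, such that \<open>F x 1 - F x 0\<close> is a nonconstant affine function of \<open>x\<close> modulo \<open>p\<close>. So
  \<open>2\<^bsup>\<Delta>(f)-2\<^esup>\<close> copies of the box simulate a noisy box for the product of Alice's input with a bit
  of Bob, which is all that a random access code needs: \<open>x\<^sub>i = x\<^sub>0 + (\<Sum>k=1..<K. [i = k] (x\<^sub>k - x\<^sub>0))\<close>
  uses \<open>K - 1\<close> products for \<open>K\<close> values. Nesting such codes gives codes for \<open>K\<^sup>n\<close> values in which
  Bob's answer depends on only \<open>n (K - 1)\<close> of the products.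

  Bob's guess is off by a signed sum of \<open>L\<close> noise terms, each of which takes the value \<open>j\<close> with
  probability at least \<open>\<nu>\<^sub>j\<close> whatever happened before, hence he succeeds with probability at least
  the \<open>L\<close>-fold convolution of \<open>\<nu>\<close> and its reflection, whose Fourier expansion is the left-hand
  side of the bound. Fano's inequality converts the success probability into mutual
  information, which information causality limits.
\<close>

section \<open>Finite differences and coefficients modulo a prime\<close>

definition fdiff :: "(nat \<Rightarrow> int) \<Rightarrow> nat \<Rightarrow> int" where
  "fdiff g x = g (Suc x) - g x"

lemma fdiff_pow_Suc: "(fdiff ^^ Suc n) g x = (fdiff ^^ n) g (Suc x) - (fdiff ^^ n) g x"
  using fdiff_def[of "(fdiff ^^ n) g" x] by simp

lemma fdiff_pow_sum:
  "(fdiff ^^ n) (\<lambda>x. \<Sum>i\<in>I. c i * g i x) = (\<lambda>x. \<Sum>i\<in>I. c i * (fdiff ^^ n) (g i) x)"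
proof (induction n)
  case (Suc n)
  show ?case
    by (rule ext) (simp add: Suc fdiff_pow_Suc sum_subtractf[symmetric] right_diff_distrib
      del: funpow.simps)
qed simp

lemma fdiff_power: "fdiff (\<lambda>x. int x ^ i) = (\<lambda>x. \<Sum>k<i. int (i choose k) * int x ^ k)"
proof
  fix x
  have "int (Suc x) ^ i = (int x + 1) ^ i" by (simp add: add.commute)
  also have "\<dots> = (\<Sum>k\<le>i. int (i choose k) * int x ^ k)"
    by (subst binomial_ring) simp
  also have "\<dots> = (\<Sum>k<i. int (i choose k) * int x ^ k) + int x ^ i"
    by (simp add: lessThan_Suc_atMost[symmetric])
  finally show "fdiff (\<lambda>x. int x ^ i) x = (\<Sum>k<i. int (i choose k) * int x ^ k)"
    by (simp add: fdiff_def)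
qed

text \<open>One difference turns a power into a combination of strictly lower powers, so by
  induction \<open>n\<close> differences annihilate every degree below \<open>n\<close> and leave
  the factorial at degree \<open>n\<close>.\<close>

lemma fdiff_pow_power:
  "i \<le> n \<Longrightarrow> (fdiff ^^ n) (\<lambda>x. int x ^ i) x = (if i = n then fact n else 0)"
proof (induction n arbitrary: i)
  case (Suc n)
  have "(fdiff ^^ Suc n) (\<lambda>x. int x ^ i) x = (fdiff ^^ n) (fdiff (\<lambda>x. int x ^ i)) x"
    by (simp add: funpow_swap1)
  also have "\<dots> = (\<Sum>k<i. int (i choose k) * (fdiff ^^ n) (\<lambda>x. int x ^ k) x)"
    by (simp add: fdiff_power fdiff_pow_sum)
  also have "\<dots> = (\<Sum>k<i. if k = n then int (i choose n) * fact n else 0)"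
    using Suc by (intro sum.cong) auto
  also have "\<dots> = (if i = Suc n then fact (Suc n) else 0)"
    using Suc.prems by auto
  finally show ?case .
qed simp

text \<open>If \<open>n\<close> were the last index at which \<open>p\<close> does not divide the
  coefficient difference \<open>g n\<close>, the \<open>n\<close>-th finite difference at 0 would be
  \<open>g n * fact n\<close> modulo \<open>p\<close>. It vanishes modulo \<open>p\<close>, yet
  \<open>fact n\<close> is prime to \<open>p\<close> since \<open>n < p\<close>.\<close>

lemma coeffs_cong_unique:
  fixes c d :: "nat \<Rightarrow> int"
  assumes p: "prime p"
    and eq: "\<And>x. x < p \<Longrightarrow> [(\<Sum>i<p. c i * int x ^ i) = (\<Sum>i<p. d i * int x ^ i)] (mod int p)"
    and i: "i < p"
  shows "[c i = d i] (mod int p)"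
proof (rule ccontr)
  define g where "g i = c i - d i" for i
  define G where "G x = (\<Sum>i<p. g i * int x ^ i)" for x
  \<comment> \<open>Iterated differences reach arguments beyond \<open>p - 1\<close>, so vanishing
    is needed at every natural number.\<close>
  have G0: "int p dvd G x" for x
  proof -
    have "[G x = G (x mod p)] (mod int p)"
      unfolding G_def
      by (intro cong_sum cong_mult cong_pow cong_refl) (simp add: cong_def of_nat_mod)
    moreover have "int p dvd G (x mod p)"
      using eq[of "x mod p"] p prime_gt_0_nat
      by (simp add: G_def g_def left_diff_distrib sum_subtractf cong_iff_dvd_diff)
    ultimately show ?thesis by (simp add: cong_dvd_iff)
  qed
  assume "\<not> [c i = d i] (mod int p)"
  then have gi: "\<not> int p dvd g i" by (simp add: g_def cong_iff_dvd_diff)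
  define n where "n = Max {i. i < p \<and> \<not> int p dvd g i}"
  have fin: "finite {i. i < p \<and> \<not> int p dvd g i}" by simp
  have n: "n < p" "\<not> int p dvd g n"
    using Max_in[OF fin] gi i unfolding n_def[symmetric] by auto
  have gt: "int p dvd g k" if "n < k" "k < p" for k
    using Max_ge[OF fin, of k] that unfolding n_def by fastforce
  have dv: "int p dvd (fdiff ^^ k) G x" for k x
    by (induction k arbitrary: x) (auto simp: G0 fdiff_def)
  have "(fdiff ^^ n) G 0 = (\<Sum>i<p. g i * (fdiff ^^ n) (\<lambda>x. int x ^ i) 0)"
    unfolding G_def by (simp add: fdiff_pow_sum)
  also have "[\<dots> = (\<Sum>i<p. if i = n then g n * fact n else 0)] (mod int p)"
  proof (rule cong_sum)
    fix j assume "j \<in> {..<p}"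
    then show "[g j * (fdiff ^^ n) (\<lambda>x. int x ^ j) 0 = (if j = n then g n * fact n else 0)] (mod int p)"
      using gt[of j] by (cases "j \<le> n") (auto simp: fdiff_pow_power cong_0_iff)
  qed
  finally have "int p dvd g n * fact n"
    using dv[of n 0] n by (simp add: cong_dvd_iff)
  then have "int p dvd fact n" using n p by (simp add: prime_dvd_mult_iff)
  then have "p dvd fact n" by (metis of_nat_dvd_iff of_nat_fact)
  then show False using n p by (simp add: prime_dvd_fact_iff)
qed

text \<open>This makes the definite description in \<open>poly_coeffs\<close> meaningful. Reduced
  coefficient arrays and value tables form the same finite set \<open>A\<close>, and evaluation
  \<open>ev\<close> is injective on it, hence surjective.\<close>

lemma poly_coeffs_spec:
  assumes p: "prime p" and f: "\<forall>x y. x < p \<longrightarrow> y < p \<longrightarrow> f x y < p"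
  shows "x < p \<Longrightarrow> y < p \<Longrightarrow>
    f x y = (\<Sum>i<p. \<Sum>j<p. poly_coeffs p f i j * x ^ i * y ^ j) mod p"
    and "poly_coeffs p f i j < p"
proof -
  define A :: "(nat \<Rightarrow> nat \<Rightarrow> nat) set" where
    "A = {l. \<forall>i j. l i j < p \<and> ((i \<ge> p \<or> j \<ge> p) \<longrightarrow> l i j = 0)}"
  define ev where "ev l = (\<lambda>x y. if x < p \<and> y < p
    then (\<Sum>i<p. \<Sum>j<p. l i j * x ^ i * y ^ j) mod p else 0)" for l :: "nat \<Rightarrow> nat \<Rightarrow> nat"
  have p0: "p > 0" using p prime_gt_0_nat by blast
  have "A \<subseteq> (\<lambda>g i j. if i < p \<and> j < p then g (i, j) else 0) ` PiE ({..<p} \<times> {..<p}) (\<lambda>_. {..<p})"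
  proof
    fix l assume l: "l \<in> A"
    show "l \<in> (\<lambda>g i j. if i < p \<and> j < p then g (i, j) else 0) ` PiE ({..<p} \<times> {..<p}) (\<lambda>_. {..<p})"
      by (rule image_eqI[of _ _ "restrict (\<lambda>(i, j). l i j) ({..<p} \<times> {..<p})"])
        (use l in \<open>auto simp: A_def fun_eq_iff\<close>)
  qed
  then have finA: "finite A" by (rule finite_subset) (auto intro!: finite_imageI finite_PiE)
  have evA: "ev ` A \<subseteq> A" using p0 by (auto simp: A_def ev_def)
  have inj: "inj_on ev A"
  proof (intro inj_onI ext)
    fix l k i j assume lk: "l \<in> A" "k \<in> A" "ev l = ev k"
    have 1: "[(\<Sum>i<p. \<Sum>j<p. int (l i j) * int x ^ i * int y ^ j) =
           (\<Sum>i<p. \<Sum>j<p. int (k i j) * int x ^ i * int y ^ j)] (mod int p)" if "x < p" "y < p" for x y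
    proof -
      have "[(\<Sum>i<p. \<Sum>j<p. l i j * x ^ i * y ^ j) = (\<Sum>i<p. \<Sum>j<p. k i j * x ^ i * y ^ j)] (mod p)"
        using fun_cong[OF fun_cong[OF lk(3)], of x y] that by (simp add: ev_def cong_def)
      then show ?thesis unfolding cong_int_iff[symmetric] by simp
    qed
    \<comment> \<open>Uniqueness in one variable is applied twice: for fixed \<open>y\<close> it
      compares the coefficients of the powers of \<open>x\<close>, which are themselves polynomials
      in \<open>y\<close> and are compared next.\<close>
    have 2: "[(\<Sum>j<p. int (l i j) * int y ^ j) = (\<Sum>j<p. int (k i j) * int y ^ j)] (mod int p)"
      if "i < p" "y < p" for i y
      by (rule coeffs_cong_unique[OF p _ that(1)])
        (use 1[OF _ that(2)] in \<open>simp add: sum_distrib_left sum_distrib_right mult.assoc mult.commute mult.left_commute\<close>)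
    have 3: "[int (l i j) = int (k i j)] (mod int p)" if "i < p" "j < p"
      by (rule coeffs_cong_unique[OF p 2[OF that(1)] that(2)])
    show "l i j = k i j"
    proof (cases "i < p \<and> j < p")
      case True
      then have "[l i j = k i j] (mod p)" using 3 by (simp add: cong_int_iff)
      then show ?thesis using lk by (auto simp: A_def cong_def)
    next
      case False
      then show ?thesis using lk by (auto simp: A_def)
    qed
  qed
  have surj: "ev ` A = A" by (rule endo_inj_surj[OF finA evA inj])
  have "(\<lambda>x y. if x < p \<and> y < p then f x y else 0) \<in> ev ` A"
    unfolding surj using f p0 by (auto simp: A_def)
  then obtain l where l: "l \<in> A" "(\<lambda>x y. if x < p \<and> y < p then f x y else 0) = ev l" by auto
  have P: "(l' \<in> A \<and> (\<forall>x y. x < p \<longrightarrow> y < p \<longrightarrow>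
          f x y = (\<Sum>i<p. \<Sum>j<p. l' i j * x ^ i * y ^ j) mod p)) \<longleftrightarrow> l' = l" for l'
  proof
    assume *: "l' \<in> A \<and> (\<forall>x y. x < p \<longrightarrow> y < p \<longrightarrow>
          f x y = (\<Sum>i<p. \<Sum>j<p. l' i j * x ^ i * y ^ j) mod p)"
    then have "ev l' = ev l" unfolding l(2)[symmetric] by (auto simp: ev_def fun_eq_iff)
    then show "l' = l" using * l inj by (auto dest: inj_onD)
  next
    assume "l' = l"
    moreover have "f x y = (\<Sum>i<p. \<Sum>j<p. l i j * x ^ i * y ^ j) mod p" if "x < p" "y < p" for x y
      using fun_cong[OF fun_cong[OF l(2)], of x y] that by (simp add: ev_def)
    ultimately show "l' \<in> A \<and> (\<forall>x y. x < p \<longrightarrow> y < p \<longrightarrow>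
          f x y = (\<Sum>i<p. \<Sum>j<p. l' i j * x ^ i * y ^ j) mod p)" using l by auto
  qed
  have "poly_coeffs p f = (THE l'. l' = l)"
    unfolding poly_coeffs_def using P by (simp add: A_def)
  then have "poly_coeffs p f = l" by simp
  then show "x < p \<Longrightarrow> y < p \<Longrightarrow>
    f x y = (\<Sum>i<p. \<Sum>j<p. poly_coeffs p f i j * x ^ i * y ^ j) mod p"
    and "poly_coeffs p f i j < p"
    using P[of l] by (auto simp: A_def)
qed

text \<open>A positive maximum is attained at a nonzero coefficient and not at a filler value 0.
  Both exponents are positive; written as successors they leave \<open>a\<close> and
  \<open>b\<close> as the numbers of differences to take.\<close>

lemma Delta_witness:
  assumes "1 < p" "Delta p f > 2"
  obtains a b where "Suc a + Suc b = Delta p f" "Suc a < p" "Suc b < p"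
    "poly_coeffs p f (Suc a) (Suc b) \<noteq> 0"
    "\<And>i j. \<lbrakk>1 \<le> i; i < p; 1 \<le> j; j < p; poly_coeffs p f i j \<noteq> 0\<rbrakk> \<Longrightarrow> i + j \<le> Delta p f"
proof -
  define D where "D = {(if poly_coeffs p f i j \<noteq> 0 then i + j else 0) | i j.
                      1 \<le> i \<and> i \<le> p - 1 \<and> 1 \<le> j \<and> j \<le> p - 1}"
  have "D \<subseteq> (\<lambda>(i, j). if poly_coeffs p f i j \<noteq> 0 then i + j else 0) ` ({1..p-1} \<times> {1..p-1})"
  proof
    fix d assume "d \<in> D"
    then obtain i j where ij: "d = (if poly_coeffs p f i j \<noteq> 0 then i + j else 0)"
      "1 \<le> i" "i \<le> p - 1" "1 \<le> j" "j \<le> p - 1" unfolding D_def by blast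
    then show "d \<in> (\<lambda>(i, j). if poly_coeffs p f i j \<noteq> 0 then i + j else 0) ` ({1..p-1} \<times> {1..p-1})"
      by (intro image_eqI[of _ _ "(i, j)"]) auto
  qed
  then have fin: "finite D" by (rule finite_subset) simp
  have De: "Delta p f = Max D" by (simp add: Delta_def D_def)
  have "D \<noteq> {}" using assms(1) by (auto simp: D_def intro!: exI[of _ 1])
  then have "Delta p f \<in> D" using fin De by simp
  then obtain i j where ij: "1 \<le> i" "i \<le> p - 1" "1 \<le> j" "j \<le> p - 1"
    "Delta p f = (if poly_coeffs p f i j \<noteq> 0 then i + j else 0)"
    unfolding D_def by auto
  show thesis
  proof (rule that[of "i - 1" "j - 1"])
    show "i' + j' \<le> Delta p f"
      if "1 \<le> i'" "i' < p" "1 \<le> j'" "j' < p" "poly_coeffs p f i' j' \<noteq> 0" for i' j'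
    proof -
      have "i' + j' \<in> D" unfolding D_def using that
        by (intro CollectI exI[of _ i'] exI[of _ j']) auto
      then show ?thesis using De fin by simp
    qed
  qed (use ij assms in \<open>auto split: if_splits\<close>)
qed

text \<open>Every difference replaces the list by a shifted copy followed by a copy with opposite
  signs, which doubles the length. The signs of the two copies are complementary, so they balance
  from the first difference on; the starting list \<open>[(1, 0, 0)]\<close> is unbalanced, hence
  the proviso \<open>a + b > 0\<close>. Products \<open>g x * h y\<close> are enough because
  \<open>f\<close> is a combination of monomials.\<close>

lemma signed_shifts_exist:
  "\<exists>L :: (int \<times> nat \<times> nat) list. length L = 2 ^ (a + b) \<and> (\<forall>z \<in> set L. fst z = 1 \<or> fst z = -1) \<and>
     (a + b > 0 \<longrightarrow> 2 * length (filter (\<lambda>z. fst z = 1) L) = 2 ^ (a + b)) \<and>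
     (\<forall>g h x y. (\<Sum>(\<sigma>, s, t) \<leftarrow> L. \<sigma> * (g (x + s) * h (y + t))) = (fdiff ^^ a) g x * (fdiff ^^ b) h y)"
proof -
  have neg: "(\<Sum>(\<sigma>, s, t) \<leftarrow> map (\<lambda>(\<sigma>, s, t). (- \<sigma>, s, t)) L. \<sigma> * k s t) =
      - (\<Sum>(\<sigma>, s, t) \<leftarrow> L. \<sigma> * k s t)" for L :: "(int \<times> nat \<times> nat) list" and k
    by (induction L) auto
  have cnt: "length (filter (\<lambda>z. fst z = 1) L) +
      length (filter (\<lambda>z. fst z = 1) (map (\<lambda>(\<sigma>, s, t). (- \<sigma>, s, t)) L)) = length L"
    if "\<forall>z \<in> set L. fst z = 1 \<or> fst z = -1" for L :: "(int \<times> nat \<times> nat) list"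
    using that by (induction L) auto
  have flt: "filter (\<lambda>z. fst z = 1) (map (\<lambda>(\<sigma>, s, t). (\<sigma>, F s, G t)) L) =
      map (\<lambda>(\<sigma>, s, t). (\<sigma>, F s, G t)) (filter (\<lambda>z. fst z = 1) L)"
    for L :: "(int \<times> nat \<times> nat) list" and F G :: "nat \<Rightarrow> nat"
    by (induction L) auto
  have app: "(\<Sum>z \<leftarrow> L @ L'. k z) = (\<Sum>z \<leftarrow> L. k z) + (\<Sum>z \<leftarrow> L'. k z)"
    for L L' :: "(int \<times> nat \<times> nat) list" and k :: "_ \<Rightarrow> int" by simp
  show ?thesis
  proof (induction a)
    case 0
    show ?case
    proof (induction b)
      case 0
      show ?case by (rule exI[of _ "[(1, 0, 0)]"]) simp
    next
      case (Suc b)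
      then obtain L :: "(int \<times> nat \<times> nat) list" where L: "length L = 2 ^ b"
        "\<forall>z \<in> set L. fst z = 1 \<or> fst z = -1"
        "\<And>g h x y. (\<Sum>(\<sigma>, s, t) \<leftarrow> L. \<sigma> * (g (x + s) * h (y + t))) = g x * (fdiff ^^ b) h y"
        by auto
      have sh: "(\<Sum>(\<sigma>, s, t) \<leftarrow> map (\<lambda>(\<sigma>, s, t). (\<sigma>, s, Suc t)) L. \<sigma> * (g (x + s) * h (y + t))) =
         (\<Sum>(\<sigma>, s, t) \<leftarrow> L. \<sigma> * (g (x + s) * h (Suc y + t)))" for g h x y
        by (simp add: o_def case_prod_beta')
      have key: "(\<Sum>(\<sigma>, s, t) \<leftarrow> map (\<lambda>(\<sigma>, s, t). (\<sigma>, s, Suc t)) L @ map (\<lambda>(\<sigma>, s, t). (- \<sigma>, s, t)) L. \<sigma> * (g (x + s) * h (y + t))) =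
          g x * (fdiff ^^ Suc b) h y" for g h x y
        unfolding app sh neg L(3) by (simp add: fdiff_pow_Suc right_diff_distrib del: funpow.simps)
      show ?case
        by (rule exI[of _ "map (\<lambda>(\<sigma>, s, t). (\<sigma>, s, Suc t)) L @ map (\<lambda>(\<sigma>, s, t). (- \<sigma>, s, t)) L"], unfold key)
          (use L(1,2) cnt[OF L(2)] flt[of id Suc L] in auto)
    qed
  next
    case (Suc a)
    then obtain L :: "(int \<times> nat \<times> nat) list" where L: "length L = 2 ^ (a + b)"
        "\<forall>z \<in> set L. fst z = 1 \<or> fst z = -1"
        "\<And>g h x y. (\<Sum>(\<sigma>, s, t) \<leftarrow> L. \<sigma> * (g (x + s) * h (y + t))) = (fdiff ^^ a) g x * (fdiff ^^ b) h y"
      by auto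
    have sh: "(\<Sum>(\<sigma>, s, t) \<leftarrow> map (\<lambda>(\<sigma>, s, t). (\<sigma>, Suc s, t)) L. \<sigma> * (g (x + s) * h (y + t))) =
         (\<Sum>(\<sigma>, s, t) \<leftarrow> L. \<sigma> * (g (Suc x + s) * h (y + t)))" for g h x y
      by (simp add: o_def case_prod_beta')
    have key: "(\<Sum>(\<sigma>, s, t) \<leftarrow> map (\<lambda>(\<sigma>, s, t). (\<sigma>, Suc s, t)) L @ map (\<lambda>(\<sigma>, s, t). (- \<sigma>, s, t)) L. \<sigma> * (g (x + s) * h (y + t))) =
        (fdiff ^^ Suc a) g x * (fdiff ^^ b) h y" for g h x y
      unfolding app sh neg L(3) by (simp add: fdiff_pow_Suc left_diff_distrib del: funpow.simps)
    show ?case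
      by (rule exI[of _ "map (\<lambda>(\<sigma>, s, t). (\<sigma>, Suc s, t)) L @ map (\<lambda>(\<sigma>, s, t). (- \<sigma>, s, t)) L"], unfold key)
        (use L(1,2) cnt[OF L(2)] flt[of Suc id L] in auto)
  qed
qed

section \<open>Affine combinations of shifts\<close>

text \<open>The signed shifts take \<open>a\<close> differences of \<open>f\<close> in
  \<open>x\<close> and \<open>b\<close> in \<open>y\<close>, so the change from \<open>y = 0\<close>
  to \<open>y = 1\<close> is one further difference in \<open>y\<close>. Its slope in
  \<open>x\<close> is constant: \<open>Suc a\<close> and \<open>Suc b\<close> differences kill
  monomials of smaller degree in either variable, and maximality of the total degree leaves only the
  chosen one. Its factorials are prime to \<open>p\<close>, so the slope \<open>C\<close> is
  too.\<close>

lemma linearising_shifts: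
  assumes p: "prime p" and f: "\<forall>x y. x < p \<longrightarrow> y < p \<longrightarrow> f x y < p" and D: "Delta p f > 2"
  obtains \<sigma> :: "nat \<Rightarrow> int" and s t :: "nat \<Rightarrow> nat" and \<kappa> C :: int
  where "\<And>l. l < 2 ^ (Delta p f - 2) \<Longrightarrow> \<sigma> l = 1 \<or> \<sigma> l = -1"
    and "2 * card {l \<in> {..<2 ^ (Delta p f - 2)}. \<sigma> l = 1} = 2 ^ (Delta p f - 2)"
    and "\<not> int p dvd C"
    and "\<And>x. [(\<Sum>l<2 ^ (Delta p f - 2). \<sigma> l * int (f ((x + s l) mod p) ((1 + t l) mod p)))
             - (\<Sum>l<2 ^ (Delta p f - 2). \<sigma> l * int (f ((x + s l) mod p) ((0 + t l) mod p)))
             = \<kappa> + C * int x] (mod int p)"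
proof -
  define lam where "lam = poly_coeffs p f"
  have p0: "p > 0" using p prime_gt_0_nat by blast
  obtain a b where ab: "Suc a + Suc b = Delta p f" "Suc a < p" "Suc b < p" "lam (Suc a) (Suc b) \<noteq> 0"
    "\<And>i j. \<lbrakk>1 \<le> i; i < p; 1 \<le> j; j < p; lam i j \<noteq> 0\<rbrakk> \<Longrightarrow> i + j \<le> Delta p f"
    using Delta_witness[OF prime_gt_1_nat[OF p] D] unfolding lam_def by metis
  have De: "Delta p f - 2 = a + b" using ab(1) by simp
  have abp: "a + b > 0" using ab(1) D by linarith
  define M :: nat where "M = 2 ^ (a + b)"
  obtain L :: "(int \<times> nat \<times> nat) list" where L: "length L = M"
      "\<forall>z \<in> set L. fst z = 1 \<or> fst z = -1"
      "2 * length (filter (\<lambda>z. fst z = 1) L) = M"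
      "\<And>g h x y. (\<Sum>(\<sigma>, s, t) \<leftarrow> L. \<sigma> * (g (x + s) * h (y + t))) = (fdiff ^^ a) g x * (fdiff ^^ b) h y"
    using signed_shifts_exist[of a b] abp unfolding M_def by metis
  define \<sigma> s t where "\<sigma> l = fst (L ! l)" and "s l = fst (snd (L ! l))" and "t l = snd (snd (L ! l))" for l
  define G where "G x y = (\<Sum>i<p. \<Sum>j<p. int (lam i j) * (int x ^ i * int y ^ j))" for x y :: nat
  have fG: "[int (f (x mod p) (y mod p)) = G x y] (mod int p)" for x y
  proof -
    have "f (x mod p) (y mod p) = (\<Sum>i<p. \<Sum>j<p. lam i j * (x mod p) ^ i * (y mod p) ^ j) mod p"
      using poly_coeffs_spec(1)[OF p f, of "x mod p" "y mod p"] p0 unfolding lam_def by simp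
    then have "[f (x mod p) (y mod p) = (\<Sum>i<p. \<Sum>j<p. lam i j * (x mod p) ^ i * (y mod p) ^ j)] (mod p)"
      by (simp add: cong_def)
    then have "[int (f (x mod p) (y mod p)) = (\<Sum>i<p. \<Sum>j<p. int (lam i j) * (int (x mod p) ^ i * int (y mod p) ^ j))] (mod int p)"
      unfolding cong_int_iff[symmetric] by (simp add: mult.assoc)
    also have "[(\<Sum>i<p. \<Sum>j<p. int (lam i j) * (int (x mod p) ^ i * int (y mod p) ^ j)) = G x y] (mod int p)"
      unfolding G_def by (intro cong_sum cong_mult cong_pow cong_refl) (simp_all add: cong_def of_nat_mod)
    finally show ?thesis .
  qed
  define X where "X i = (\<lambda>x :: nat. int x ^ i)" for i
  have GL: "(\<Sum>l<M. \<sigma> l * G (x + s l) (y + t l)) =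
      (\<Sum>i<p. \<Sum>j<p. int (lam i j) * ((fdiff ^^ a) (X i) x * (fdiff ^^ b) (X j) y))" for x y
  proof -
    have "(\<Sum>l<M. \<sigma> l * (g (x + s l) * h (y + t l))) = (fdiff ^^ a) g x * (fdiff ^^ b) h y" for g h
      unfolding L(4)[symmetric] \<sigma>_def s_def t_def using L(1)
      by (simp add: sum_list_sum_nth atLeast0LessThan case_prod_beta)
    note this[symmetric, unfolded X_def]
    then show ?thesis unfolding G_def X_def
      by (simp add: sum_distrib_left mult.left_commute) (subst sum.swap, rule sum.cong[OF refl], rule sum.swap)
  qed
  define \<Phi> where "\<Phi> x = (\<Sum>l<M. \<sigma> l * G (x + s l) (1 + t l)) - (\<Sum>l<M. \<sigma> l * G (x + s l) (0 + t l))" for x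
  have \<Phi>: "\<Phi> x = (\<Sum>i<p. \<Sum>j<p. int (lam i j) * ((fdiff ^^ a) (X i) x * (fdiff ^^ Suc b) (X j) 0))" for x
    unfolding \<Phi>_def GL
    by (simp add: fdiff_pow_Suc sum_subtractf right_diff_distrib del: funpow.simps)
  define C where "C = int (lam (Suc a) (Suc b)) * (fact (Suc a) * fact (Suc b))"
  have step: "\<Phi> (Suc x) - \<Phi> x = C" for x
  proof -
    have "\<Phi> (Suc x) - \<Phi> x =
        (\<Sum>i<p. \<Sum>j<p. int (lam i j) * ((fdiff ^^ Suc a) (X i) x * (fdiff ^^ Suc b) (X j) 0))"
      unfolding \<Phi> fdiff_pow_Suc[of a]
      by (simp add: sum_subtractf right_diff_distrib left_diff_distrib del: funpow.simps)
    also have "\<dots> = (\<Sum>i<p. \<Sum>j<p. if i = Suc a \<and> j = Suc b then C else 0)"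
    proof (intro sum.cong refl)
      fix i j assume ij: "i \<in> {..<p}" "j \<in> {..<p}"
      consider "i < Suc a" | "j < Suc b" | "lam i j = 0" | "i = Suc a" "j = Suc b"
        | "i \<ge> Suc a" "j \<ge> Suc b" "lam i j \<noteq> 0" "\<not> (i = Suc a \<and> j = Suc b)" by linarith
      then show "int (lam i j) * ((fdiff ^^ Suc a) (X i) x * (fdiff ^^ Suc b) (X j) 0) =
          (if i = Suc a \<and> j = Suc b then C else 0)"
      proof cases
        case 5
        then have "i + j > Delta p f" using ab(1) by linarith
        moreover have "i + j \<le> Delta p f" using ab(5)[of i j] 5 ij by auto
        ultimately show ?thesis by simp
      qed (use ab(4) in \<open>auto simp: X_def fdiff_pow_power C_def simp del: funpow.simps fact_Suc power_Suc\<close>)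
    qed
    also have "\<dots> = (\<Sum>i<p. if i = Suc a then C else 0)"
      by (intro sum.cong refl) (use ab(3) in auto)
    also have "\<dots> = C" using ab(2) by simp
    finally show ?thesis .
  qed
  have lin: "\<Phi> x = \<Phi> 0 + C * int x" for x
  proof (induction x)
    case (Suc x)
    then show ?case using step[of x] by (simp add: algebra_simps)
  qed simp
  have pf: "\<not> int p dvd fact k" if "k < p" for k
    using that p prime_dvd_fact_iff[of p k] by (metis leD of_nat_dvd_iff of_nat_fact)
  have "\<not> int p dvd int (lam (Suc a) (Suc b))"
    using ab(4) poly_coeffs_spec(2)[OF p f, of "Suc a" "Suc b"] unfolding lam_def[symmetric]
    by (simp add: nat_dvd_not_less)
  then have C: "\<not> int p dvd C"
    unfolding C_def using pf ab(2,3) p by (simp add: prime_dvd_mult_iff del: fact_Suc)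
  have cs: "[(\<Sum>l<M. \<sigma> l * int (f ((x + s l) mod p) ((y + t l) mod p))) = (\<Sum>l<M. \<sigma> l * G (x + s l) (y + t l))] (mod int p)" for x y
    by (intro cong_sum cong_mult cong_refl fG)
  show thesis
  proof (rule that[of \<sigma> C s t "\<Phi> 0"], unfold De M_def[symmetric])
    show "\<sigma> l = 1 \<or> \<sigma> l = -1" if "l < M" for l
      using that L(1,2) by (simp add: \<sigma>_def)
    have "length (filter (\<lambda>z. fst z = 1) L) = card {l \<in> {..<M}. \<sigma> l = 1}"
      by (simp add: length_filter_conv_card L(1) \<sigma>_def)
    then show "2 * card {l \<in> {..<M}. \<sigma> l = 1} = M" using L(3) by simp
    show "[(\<Sum>l<M. \<sigma> l * int (f ((x + s l) mod p) ((1 + t l) mod p)))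
             - (\<Sum>l<M. \<sigma> l * int (f ((x + s l) mod p) ((0 + t l) mod p)))
             = \<Phi> 0 + C * int x] (mod int p)" for x
      using cong_diff[OF cs[of x 1] cs[of x 0]] unfolding lin[symmetric] \<Phi>_def[of x] .
  qed (rule C)
qed

section \<open>Random access codes from products\<close>

text \<open>
  Alice's data \<open>xv\<close> is encoded with \<open>m\<close> product boxes with inputs \<open>X\<close> (Alice) and \<open>Y\<close> (Bob), where
  \<open>\<alpha>\<close> lists Alice's outputs; \<open>Q\<close> is her message and \<open>R i\<close> the set of boxes that Bob reads to
  retrieve \<open>xv i\<close>. A box whose outputs satisfy \<open>\<alpha> t - \<beta> t = Y t i * X t + \<phi> (X t)\<close> makes
  \<open>Q - (\<Sum>t\<in>R i. \<beta> t)\<close> equal to \<open>xv i\<close>; the offset \<open>\<phi>\<close> is what the simulated boxes produce for \<open>Y = 0\<close>.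
\<close>
definition xcode :: "(int \<Rightarrow> int) \<Rightarrow> nat \<Rightarrow> nat \<Rightarrow> nat \<Rightarrow> (nat \<Rightarrow> (nat \<Rightarrow> int) \<Rightarrow> (nat \<Rightarrow> int) \<Rightarrow> int) \<Rightarrow>
    (nat \<Rightarrow> nat \<Rightarrow> nat) \<Rightarrow> (nat \<Rightarrow> nat set) \<Rightarrow> ((nat \<Rightarrow> int) \<Rightarrow> (nat \<Rightarrow> int) \<Rightarrow> int) \<Rightarrow> bool" where
  "xcode \<phi> N m r X Y R Q \<longleftrightarrow>
    (\<forall>t xv \<alpha> \<alpha>'. (\<forall>s<t. \<alpha> s = \<alpha>' s) \<longrightarrow> X t xv \<alpha> = X t xv \<alpha>') \<and>
    (\<forall>t i. Y t i \<le> 1) \<and>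
    (\<forall>i<N. R i \<subseteq> {..<m} \<and> card (R i) = r) \<and>
    (\<forall>i<N. \<forall>xv \<alpha>. Q xv \<alpha> =
        xv i + (\<Sum>t\<in>R i. \<alpha> t - int (Y t i) * X t xv \<alpha> - \<phi> (X t xv \<alpha>)))"

lemma xcode_trivial: "\<exists>X Y R Q. xcode \<phi> 1 0 0 X Y R Q"
  by (rule exI[of _ "\<lambda>_ _ _. 0"], rule exI[of _ "\<lambda>_ _. 0"], rule exI[of _ "\<lambda>_. {}"],
      rule exI[of _ "\<lambda>xv _. xv 0"]) (simp add: xcode_def)

text \<open>Each of the \<open>N\<close> values of the given code becomes a block of
  \<open>Suc K\<close> values. Alice compresses block \<open>g\<close> into one number with
  \<open>K\<close> products and encodes these numbers by the given code; Bob reads the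
  \<open>K\<close> boxes of the block containing \<open>i\<close> and the \<open>r\<close> boxes
  that retrieve its number.\<close>

lemma xcode_step:
  assumes "xcode \<phi> N m r X Y R Q"
  shows "\<exists>X' Y' R' Q'. xcode \<phi> (N * Suc K) (N * K + m) (r + K) X' Y' R' Q'"
proof -
  have X: "X t xv \<alpha> = X t xv \<alpha>'" if "\<And>s. s < t \<Longrightarrow> \<alpha> s = \<alpha>' s" for t xv \<alpha> \<alpha>'
    using assms that unfolding xcode_def by blast
  have Y: "Y t i \<le> 1" for t i using assms unfolding xcode_def by blast
  have R: "R i \<subseteq> {..<m}" "card (R i) = r" if "i < N" for i
    using assms that unfolding xcode_def by blast+
  have Q: "Q xv \<alpha> = xv i + (\<Sum>t\<in>R i. \<alpha> t - int (Y t i) * X t xv \<alpha> - \<phi> (X t xv \<alpha>))"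
    if "i < N" for i xv \<alpha> using assms that unfolding xcode_def by blast
  define n where "n = N * K"
  \<comment> \<open>Box \<open>k\<close> of a block multiplies the difference between values
    \<open>Suc k\<close> and 0 of the block with Bob's bit.\<close>
  define U :: "nat \<Rightarrow> (nat \<Rightarrow> int) \<Rightarrow> int" where
    "U t xv = xv (t div K * Suc K + Suc (t mod K)) - xv (t div K * Suc K)" for t xv
  define V where
    "V xv \<alpha> g = xv (g * Suc K) + (\<Sum>k<K. \<alpha> (g * K + k) - \<phi> (U (g * K + k) xv))" for xv \<alpha> g
  \<comment> \<open>The boxes of the outer code are shifted behind the \<open>n\<close> boxes of the
    blocks, so the numbers \<open>V\<close> are known when the outer inputs are chosen. The value 0
    from \<open>N\<close> on keeps \<open>V\<close> from looking at outputs of later boxes.\<close>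
  define X' where "X' t xv \<alpha> =
     (if t < n then U t xv
      else X (t - n) (\<lambda>g. if g < N then V xv \<alpha> g else 0) (\<lambda>s. \<alpha> (n + s)))" for t xv \<alpha>
  define Y' where "Y' t i = (if t < n then (if i = t div K * Suc K + Suc (t mod K) then 1 else 0)
     else Y (t - n) (i div Suc K))" for t i
  define R' where "R' i = (\<lambda>k. i div Suc K * K + k) ` {..<K} \<union> (\<lambda>s. n + s) ` R (i div Suc K)" for i
  define Q' where "Q' xv \<alpha> = Q (\<lambda>g. if g < N then V xv \<alpha> g else 0) (\<lambda>s. \<alpha> (n + s))" for xv \<alpha>
  have lt: "g * K + k < n" if "g < N" "k < K" for g k
  proof -
    have "g * K + k < Suc g * K" using that by simp
    also have "\<dots> \<le> n" unfolding n_def using that by (intro mult_right_mono) auto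
    finally show ?thesis .
  qed
  have "xcode \<phi> (N * Suc K) (N * K + m) (r + K) X' Y' R' Q'"
    unfolding xcode_def
  proof (intro conjI allI impI)
    fix t xv and \<alpha> \<alpha>' :: "nat \<Rightarrow> int" assume eq: "\<forall>s<t. \<alpha> s = \<alpha>' s"
    show "X' t xv \<alpha> = X' t xv \<alpha>'"
    proof (cases "t < n")
      case False
      have "V xv \<alpha> g = V xv \<alpha>' g" if "g < N" for g
      proof -
        have "\<alpha> (g * K + k) = \<alpha>' (g * K + k)" if "k < K" for k
          using eq lt[OF \<open>g < N\<close> that] False by simp
        then show ?thesis unfolding V_def by (intro arg_cong2[where f = "(+)"] sum.cong refl) auto
      qed
      then have "(\<lambda>g. if g < N then V xv \<alpha> g else 0) = (\<lambda>g. if g < N then V xv \<alpha>' g else 0)" by auto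
      moreover have "X (t - n) w (\<lambda>s. \<alpha> (n + s)) = X (t - n) w (\<lambda>s. \<alpha>' (n + s))" for w
        by (rule X) (use eq False in auto)
      ultimately show ?thesis using False by (simp add: X'_def)
    qed (simp add: X'_def)
  next
    show "Y' t i \<le> 1" for t i using Y by (simp add: Y'_def)
  next
    fix i assume "i < N * Suc K"
    then have g: "i div Suc K < N" by (simp add: less_mult_imp_div_less)
    show "R' i \<subseteq> {..<N * K + m}"
      using R(1)[OF g] lt[OF g] unfolding R'_def n_def by (auto intro: trans_less_add1)
    have "card (R' i) = card ((\<lambda>k. i div Suc K * K + k) ` {..<K}) + card ((\<lambda>s. n + s) ` R (i div Suc K))"
      unfolding R'_def using R(1)[OF g] lt[OF g]
      by (intro card_Un_disjoint) (auto dest: finite_subset, fastforce)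
    also have "\<dots> = r + K" using R(2)[OF g] by (subst (1 2) card_image) (auto simp: inj_on_def)
    finally show "card (R' i) = r + K" .
  next
    fix i xv and \<alpha> :: "nat \<Rightarrow> int" assume i: "i < N * Suc K"
    define g where "g = i div Suc K"
    have g: "g < N" unfolding g_def using i by (simp add: less_mult_imp_div_less)
    define F where "F t = \<alpha> t - int (Y' t i) * X' t xv \<alpha> - \<phi> (X' t xv \<alpha>)" for t
    have fR: "finite (R g)" using R(1)[OF g] finite_subset by blast
    have dm: "(g * K + k) div K = g" "(g * K + k) mod K = k" if "k < K" for k using that by auto
    have s1: "(\<Sum>k<K. F (g * K + k)) = V xv \<alpha> g - xv i"
    proof -
      have "(\<Sum>k<K. F (g * K + k)) = (\<Sum>k<K. (\<alpha> (g * K + k) - \<phi> (U (g * K + k) xv))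
           - (if i = g * Suc K + Suc k then xv i - xv (g * Suc K) else 0))"
        using lt[OF g] dm by (intro sum.cong refl) (auto simp: F_def X'_def Y'_def U_def)
      also have "\<dots> = V xv \<alpha> g - xv (g * Suc K)
           - (\<Sum>k<K. if i = g * Suc K + Suc k then xv i - xv (g * Suc K) else 0)"
        by (simp add: sum_subtractf V_def)
      also have "(\<Sum>k<K. if i = g * Suc K + Suc k then xv i - xv (g * Suc K) else 0) = xv i - xv (g * Suc K)"
      \<comment> \<open>In position 0 no bit is set and the base value of the block itself is
        recovered; in position \<open>Suc k\<close> exactly box \<open>k\<close> supplies the
        missing difference.\<close>
      proof (cases "i mod Suc K")
        case 0
        then have "i = g * Suc K" unfolding g_def by (metis add.right_neutral div_mult_mod_eq)
        then show ?thesis by simp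
      next
        case (Suc k)
        then have ik: "i = g * Suc K + Suc k" unfolding g_def by (metis div_mult_mod_eq)
        have "k < K" using Suc mod_less_divisor[of "Suc K" i] by simp
        then show ?thesis unfolding ik by simp
      qed
      finally show ?thesis by simp
    qed
    have s2: "(\<Sum>t\<in>R g. F (n + t)) = Q' xv \<alpha> - V xv \<alpha> g"
      unfolding Q'_def using Q[OF g] g
      by (simp add: F_def X'_def Y'_def g_def[symmetric])
    have "(\<Sum>t\<in>R' i. F t) = (\<Sum>t\<in>(\<lambda>k. g * K + k) ` {..<K}. F t) + (\<Sum>t\<in>(\<lambda>s. n + s) ` R g. F t)"
      unfolding R'_def g_def[symmetric] using fR lt[OF g]
      by (intro sum.union_disjoint) (auto, fastforce)
    also have "\<dots> = (\<Sum>k<K. F (g * K + k)) + (\<Sum>t\<in>R g. F (n + t))"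
      by (simp add: sum.reindex inj_on_def)
    finally show "Q' xv \<alpha> = xv i + (\<Sum>t\<in>R' i. \<alpha> t - int (Y' t i) * X' t xv \<alpha> - \<phi> (X' t xv \<alpha>))"
      unfolding F_def[symmetric] s1 s2 by simp
  qed
  then show ?thesis by blast
qed

lemma xcode_exists_linear:
  assumes "N \<ge> 1" shows "\<exists>m X Y R Q. xcode \<phi> N m (N - 1) X Y R Q"
proof -
  obtain X Y R Q where "xcode \<phi> 1 0 0 X Y R Q" using xcode_trivial[of \<phi>] by blast
  from xcode_step[OF this, of "N - 1"] obtain X' Y' R' Q' where "xcode \<phi> N (N - 1) (N - 1) X' Y' R' Q'" using assms by auto
  then show ?thesis by blast
qed

text \<open>Each level multiplies the number of values by \<open>K\<close> but adds only
  \<open>K - 1\<close> boxes to those read.\<close>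

lemma xcode_exists_power:
  assumes "K \<ge> 1" shows "\<exists>m X Y R Q. xcode \<phi> (K ^ n) m (n * (K - 1)) X Y R Q"
proof (induction n)
  case 0
  show ?case using xcode_trivial[of \<phi>] unfolding power_0 mult_0 by blast
next
  case (Suc n)
  then obtain m X Y R Q where "xcode \<phi> (K ^ n) m (n * (K - 1)) X Y R Q" by blast
  from xcode_step[OF this, of "K - 1"] obtain X' Y' R' Q' where
    "xcode \<phi> (K ^ Suc n) (K ^ n * (K - 1) + m) (Suc n * (K - 1)) X' Y' R' Q'"
    using assms by (auto simp: mult.commute add.commute)
  then show ?case by blast
qed

section \<open>Convolution modulo p\<close>

lemma omega_power_eq_1_iff:
  assumes "p > 0" shows "omega p ^ n = 1 \<longleftrightarrow> p dvd n"
proof -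
  have "omega p ^ n = exp (2 * of_real pi * \<i> * of_nat n / of_nat p)"
    unfolding omega_def by (simp add: exp_of_nat_mult[symmetric] mult.commute)
  then show ?thesis using complex_root_unity_eq_1[of p n] assms by simp
qed

lemma omega_nonzero: "omega p \<noteq> 0"
  by (simp add: omega_def)

lemma omega_inverse_power_cong:
  assumes "p > 0" "[m + n = 0] (mod p)"
  shows "inverse (omega p) ^ m = omega p ^ n"
proof -
  have "omega p ^ (m + n) = 1" using assms omega_power_eq_1_iff cong_0_iff by blast
  then show ?thesis using omega_nonzero by (simp add: power_add field_simps)
qed

lemma omega_power_cong:
  assumes "p > 0" "[m = n] (mod p)"
  shows "omega p ^ m = omega p ^ n"
proof -
  have "p dvd m + (p * m - m)" using assms by simp
  then have 1: "inverse (omega p) ^ (p * m - m) = omega p ^ m"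
    using assms by (intro omega_inverse_power_cong) (simp_all add: cong_0_iff add.commute)
  have "[(p * m - m) + n = (p * m - m) + m] (mod p)" using assms(2) cong_add_lcancel_nat cong_sym by blast
  then have "inverse (omega p) ^ (p * m - m) = omega p ^ n"
    using assms by (intro omega_inverse_power_cong) (auto simp: cong_def)
  with 1 show ?thesis by simp
qed

text \<open>The cyclic convolution of the first \<open>m\<close> weights: for probability weights,
  the law of a sum of \<open>m\<close> independent variables modulo \<open>p\<close>. The term
  \<open>t + (p - z)\<close> stands for \<open>t - z\<close> in the naturals.\<close>

primrec mod_conv :: "nat \<Rightarrow> (nat \<Rightarrow> nat \<Rightarrow> real) \<Rightarrow> nat \<Rightarrow> nat \<Rightarrow> real" where
  "mod_conv p \<mu> 0 t = (if t = 0 then 1 else 0)"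
| "mod_conv p \<mu> (Suc m) t = (\<Sum>z<p. \<mu> m z * mod_conv p \<mu> m ((t + (p - z)) mod p))"

text \<open>Fourier inversion modulo \<open>p\<close>: the point mass at 0 is handled by a geometric
  sum over the roots of unity, and translation by \<open>z\<close> multiplies the
  \<open>k\<close>-th term by \<open>omega p ^ (z * k)\<close>.\<close>

lemma mod_conv_fourier:
  assumes "p > 0" "t < p"
  shows "complex_of_real (mod_conv p \<mu> m t) =
    1 / of_nat p * (\<Sum>k<p. inverse (omega p) ^ (t * k) * (\<Prod>l<m. \<Sum>z<p. of_real (\<mu> l z) * omega p ^ (z * k)))"
  using assms(2)
proof (induction m arbitrary: t)
  case 0
  define w where "w = inverse (omega p) ^ t"
  have wk: "inverse (omega p) ^ (t * k) = w ^ k" for k by (simp add: w_def power_mult)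
  have w1: "w = 1 \<longleftrightarrow> t = 0"
    using omega_power_eq_1_iff[OF assms(1), of t] 0 by (auto simp: w_def power_inverse nat_dvd_not_less)
  have wp: "w ^ p = 1"
    using omega_power_eq_1_iff[OF assms(1), of "t * p"] by (simp add: w_def power_inverse flip: power_mult)
  have "(\<Sum>k<p. w ^ k) = (if t = 0 then of_nat p else 0)"
    using w1 wp geometric_sum[of w p] by auto
  then show ?case using assms(1) by (simp add: wk)
next
  case (Suc m)
  define H where "H k = (\<Prod>l<m. \<Sum>z<p. of_real (\<mu> l z) * omega p ^ (z * k))" for k
  have sh: "inverse (omega p) ^ ((t + (p - z)) mod p * k) = inverse (omega p) ^ (t * k) * omega p ^ (z * k)"
    if "z < p" for z k
  proof -
    have "[(t + (p - z)) mod p + z = t + (p - z) + z] (mod p)"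
      by (simp add: cong_def mod_simps)
    also have "t + (p - z) + z = t + p" using that by simp
    also have "[t + p = t] (mod p)" by (simp add: cong_def)
    finally have *: "[((t + (p - z)) mod p + z) * k = t * k] (mod p)" by (rule cong_mult) simp
    have "omega p ^ ((t + (p - z)) mod p * k) * omega p ^ (z * k) = omega p ^ (t * k)"
      using omega_power_cong[OF assms(1) *] by (simp add: power_add add_mult_distrib)
    then show ?thesis using omega_nonzero by (simp add: power_inverse field_simps)
  qed
  have "complex_of_real (mod_conv p \<mu> (Suc m) t) =
     (\<Sum>z<p. of_real (\<mu> m z) * (1 / of_nat p * (\<Sum>k<p. inverse (omega p) ^ ((t + (p - z)) mod p * k) * H k)))"
    using Suc.IH assms(1) by (simp add: H_def)
  also have "\<dots> = (\<Sum>z<p. of_real (\<mu> m z) * (1 / of_nat p *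
      (\<Sum>k<p. (inverse (omega p) ^ (t * k) * omega p ^ (z * k)) * H k)))"
    by (intro sum.cong refl arg_cong2[where f = "(*)"] sh) simp
  also have "\<dots> = (\<Sum>z<p. \<Sum>k<p. 1 / of_nat p * (inverse (omega p) ^ (t * k) * H k * (of_real (\<mu> m z) * omega p ^ (z * k))))"
    by (intro sum.cong refl) (simp add: sum_distrib_left mult_ac)
  also have "\<dots> = 1 / of_nat p * (\<Sum>k<p. inverse (omega p) ^ (t * k) * (H k * (\<Sum>z<p. of_real (\<mu> m z) * omega p ^ (z * k))))"
    by (subst sum.swap) (simp add: sum_distrib_left mult.assoc)
  finally show ?case by (simp add: H_def mult.commute)
qed

lemma sum_blocks: "(\<Sum>k<m * M. g k) = (\<Sum>t<m. \<Sum>l<M. g (t * M + l))" for M :: nat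
  by (simp add: sum.nat_group[symmetric] sum.atLeastLessThan_shift_0 atLeast0LessThan)

lemma prod_blocks: "(\<Prod>k<m * M. g k) = (\<Prod>t<m. \<Prod>l<M. g (t * M + l))" for M :: nat
  by (simp add: prod.nat_group[symmetric] prod.atLeastLessThan_shift_0 atLeast0LessThan)

text \<open>Each of the \<open>r\<close> blocks in \<open>R\<close> has equally many boxes of both
  signs; a positive one contributes the transform of \<nu>, a negative one that of its reflection,
  whence the exponents \<open>L div 2\<close>. Boxes outside \<open>R\<close> carry the point mass
  at 0 and contribute 1. The factor \<open>omega p ^ (c * k)\<close> means evaluation of the
  convolution at \<open>-c\<close>.\<close>

lemma bound_lhs_eq_mod_conv:
  fixes \<nu> :: "nat \<Rightarrow> real"
  assumes p: "p > 0" and c: "c < p" and R: "R \<subseteq> {..<m}" "card R = r"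
    and \<sigma>: "\<And>l. l < M \<Longrightarrow> \<sigma> l = 1 \<or> \<sigma> l = (-1 :: int)"
    and M: "2 * card {l \<in> {..<M}. \<sigma> l = 1} = M"
  defines "\<mu> k z \<equiv> (if k div M \<in> R then \<nu> (nat ((\<sigma> (k mod M) * int z) mod int p))
      else if z = 0 then 1 else 0)"
  shows "bound_lhs p \<nu> (r * M) c = complex_of_real (mod_conv p \<mu> (m * M) ((p - c) mod p))"
proof -
  define H where "H = card {l \<in> {..<M}. \<sigma> l = 1}"
  define \<psi> where "\<psi> s k = (\<Sum>z<p. complex_of_real (\<nu> (nat ((s * int z) mod int p))) * omega p ^ (z * k))" for s k
  have \<psi>1: "\<psi> 1 k = (\<Sum>j<p. of_real (\<nu> j) * omega p ^ (j * k))" for k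
    unfolding \<psi>_def by (intro sum.cong refl) simp
  have \<psi>2: "\<psi> (-1) k = (\<Sum>j<p. of_real (\<nu> j) * inverse (omega p) ^ (j * k))" for k
    unfolding \<psi>_def
  proof (rule sum.reindex_bij_witness[of _ "\<lambda>z. (p - z) mod p" "\<lambda>z. (p - z) mod p"])
    fix z assume "z \<in> {..<p}"
    then have z: "z < p" by simp
    have inv: "(p - (p - z) mod p) mod p = z" using z by (cases "z = 0") auto
    show "(p - (p - z) mod p) mod p = z" by (rule inv)
    show "(p - (p - z) mod p) mod p = z" by (rule inv)
    show "(p - z) mod p \<in> {..<p}" "(p - z) mod p \<in> {..<p}" using p by auto
    have "nat ((-1 * int z) mod int p) = (p - z) mod p"
    proof (cases "z = 0")
      case False
      then have "(- int z) mod int p = int p - int z"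
        using z by (simp add: zmod_zminus1_eq_if)
      then show ?thesis using False z by simp
    qed simp
    moreover have "inverse (omega p) ^ ((p - z) mod p * k) = omega p ^ (z * k)"
    proof (rule omega_inverse_power_cong[OF p])
      have "[(p - z) mod p + z = 0] (mod p)" using z by (simp add: cong_def mod_simps)
      then have "[((p - z) mod p + z) * k = 0 * k] (mod p)" by (rule cong_mult) simp
      then show "[(p - z) mod p * k + z * k = 0] (mod p)" by (simp add: add_mult_distrib)
    qed
    ultimately show "complex_of_real (\<nu> ((p - z) mod p)) * inverse (omega p) ^ ((p - z) mod p * k) =
       complex_of_real (\<nu> (nat ((-1 * int z) mod int p))) * omega p ^ (z * k)" by simp
  qed
  have pr: "(\<Prod>l<m * M. \<Sum>z<p. of_real (\<mu> l z) * omega p ^ (z * k)) = \<psi> 1 k ^ (r * H) * \<psi> (-1) k ^ (r * H)" for k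
  proof -
    have "(\<Prod>l<m * M. \<Sum>z<p. of_real (\<mu> l z) * omega p ^ (z * k)) =
        (\<Prod>t<m. \<Prod>l<M. \<Sum>z<p. of_real (\<mu> (t * M + l) z) * omega p ^ (z * k))"
      by (rule prod_blocks)
    also have "\<dots> = (\<Prod>t<m. if t \<in> R then \<Prod>l<M. \<psi> (\<sigma> l) k else 1)"
    proof (rule prod.cong[OF refl])
      fix t
      have "(\<Sum>z<p. of_real (\<mu> (t * M + l) z) * omega p ^ (z * k)) = (if t \<in> R then \<psi> (\<sigma> l) k else 1)"
        if "l < M" for l
      proof (cases "t \<in> R")
        case False
        then have "(\<Sum>z<p. complex_of_real (\<mu> (t * M + l) z) * omega p ^ (z * k)) = (\<Sum>z<p. if z = 0 then 1 else 0)"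
          using that by (intro sum.cong refl) (simp add: \<mu>_def)
        then show ?thesis using False p by simp
      qed (use that in \<open>simp add: \<mu>_def \<psi>_def\<close>)
      then show "(\<Prod>l<M. \<Sum>z<p. of_real (\<mu> (t * M + l) z) * omega p ^ (z * k)) = (if t \<in> R then \<Prod>l<M. \<psi> (\<sigma> l) k else 1)"
        by simp
    qed
    also have "\<dots> = (\<Prod>t\<in>{..<m} \<inter> R. \<Prod>l<M. \<psi> (\<sigma> l) k)"
      by (rule prod.inter_restrict[symmetric]) simp
    also have "{..<m} \<inter> R = R" using R by auto
    also have "(\<Prod>t\<in>R. \<Prod>l<M. \<psi> (\<sigma> l) k) = (\<Prod>l<M. \<psi> (\<sigma> l) k) ^ r" using R by simp
    also have "(\<Prod>l<M. \<psi> (\<sigma> l) k) = (\<Prod>l<M. if \<sigma> l = 1 then \<psi> 1 k else \<psi> (-1) k)"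
      using \<sigma> by (intro prod.cong refl) fastforce
    also have "\<dots> = \<psi> 1 k ^ H * \<psi> (-1) k ^ card {l \<in> {..<M}. \<sigma> l \<noteq> 1}"
    proof -
      have "{..<M} \<inter> {l. \<sigma> l = 1} = {l \<in> {..<M}. \<sigma> l = 1}"
        "{..<M} \<inter> - {l. \<sigma> l = 1} = {l \<in> {..<M}. \<sigma> l \<noteq> 1}" by auto
      then show ?thesis unfolding H_def by (subst prod.If_cases) simp_all
    qed
    also have "card {l \<in> {..<M}. \<sigma> l \<noteq> 1} = H"
    proof -
      have "card ({l \<in> {..<M}. \<sigma> l = 1} \<union> {l \<in> {..<M}. \<sigma> l \<noteq> 1}) = H + card {l \<in> {..<M}. \<sigma> l \<noteq> 1}"
        unfolding H_def by (rule card_Un_disjoint) auto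
      moreover have "{l \<in> {..<M}. \<sigma> l = 1} \<union> {l \<in> {..<M}. \<sigma> l \<noteq> 1} = {..<M}" by auto
      ultimately show ?thesis using M unfolding H_def by simp
    qed
    finally show ?thesis by (simp add: power_mult_distrib power_mult mult.commute[of r])
  qed
  have "r * M = 2 * (r * H)" using M unfolding H_def by simp
  then have L: "r * M div 2 = r * H" by presburger
  have w: "inverse (omega p) ^ ((p - c) mod p * k) = omega p ^ (c * k)" for k
  proof (rule omega_inverse_power_cong[OF p])
    have "[(p - c) mod p + c = 0] (mod p)" using c by (simp add: cong_def mod_simps)
    then have "[((p - c) mod p + c) * k = 0 * k] (mod p)" by (rule cong_mult) simp
    then show "[(p - c) mod p * k + c * k = 0] (mod p)" by (simp add: add_mult_distrib)
  qed
  show ?thesis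
    unfolding mod_conv_fourier[OF p mod_less_divisor[OF p]] pr w bound_lhs_def L \<psi>1 \<psi>2
    by (simp add: mult.assoc)
qed

section \<open>Adaptive use of independent boxes\<close>

lemma finite_vecs [simp]: "finite (vecs n p)"
  by (simp add: vecs_def finite_PiE)

lemma sum_vecs_Suc: "(\<Sum>v\<in>vecs (Suc m) p. G v) = (\<Sum>v\<in>vecs m p. \<Sum>a<p. G (v(m := a)))"
proof -
  have "vecs (Suc m) p = (\<lambda>(a, v). v(m := a)) ` ({..<p} \<times> vecs m p)"
    unfolding vecs_def lessThan_Suc PiE_insert_eq by simp
  moreover have "inj_on (\<lambda>(a, v). v(m := a)) ({..<p} \<times> vecs m p)"
    unfolding vecs_def using inj_combinator[of m "{..<m}" "\<lambda>_. {..<p}"] by simp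
  ultimately have "(\<Sum>v\<in>vecs (Suc m) p. G v) = (\<Sum>(a, v)\<in>{..<p} \<times> vecs m p. G (v(m := a)))"
    by (simp add: sum.reindex case_prod_beta')
  also have "\<dots> = (\<Sum>a<p. \<Sum>v\<in>vecs m p. G (v(m := a)))"
    by (simp add: sum.cartesian_product)
  finally show ?thesis by (simp add: sum.swap[of _ "vecs m p"])
qed

lemma trunc_fun_upd [simp]: "k \<le> m \<Longrightarrow> trunc k (v(m := a)) = trunc k v"
  by (auto simp: trunc_def)

lemma adaptive_total:
  assumes "\<And>k h. k < m \<Longrightarrow> (\<Sum>a<p. \<Sum>b<p. w k h a b) = (1 :: real)"
  shows "(\<Sum>av\<in>vecs m p. \<Sum>bv\<in>vecs m p. \<Prod>k<m. w k (trunc k av) (av k) (bv k)) = 1"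
  using assms
proof (induction m)
  case 0
  then show ?case by (simp add: vecs_def)
next
  case (Suc m)
  have "(\<Sum>av\<in>vecs (Suc m) p. \<Sum>bv\<in>vecs (Suc m) p. \<Prod>k<Suc m. w k (trunc k av) (av k) (bv k)) =
     (\<Sum>av\<in>vecs m p. \<Sum>a<p. \<Sum>bv\<in>vecs m p. \<Sum>b<p.
        (\<Prod>k<m. w k (trunc k av) (av k) (bv k)) * w m (trunc m av) a b)"
    by (simp add: sum_vecs_Suc)
  also have "\<dots> = (\<Sum>av\<in>vecs m p. \<Sum>bv\<in>vecs m p.
        (\<Prod>k<m. w k (trunc k av) (av k) (bv k)) * (\<Sum>a<p. \<Sum>b<p. w m (trunc m av) a b))"
    by (simp add: sum_distrib_left sum.swap[of _ "{..<p}" "vecs m p"])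
  also have "\<dots> = 1" using Suc by simp
  finally show ?case .
qed

text \<open>The noise terms need not be independent, but after any history the next one takes the
  value \<open>z\<close> with weight at least \<open>\<mu> k z\<close>. When the last box has noise
  \<open>z\<close>, the earlier noise must be \<open>t - z\<close>, which is the recursion of
  \<open>mod_conv\<close>.\<close>

lemma adaptive_sum_ge:
  fixes w :: "nat \<Rightarrow> (nat \<Rightarrow> nat) \<Rightarrow> nat \<Rightarrow> nat \<Rightarrow> real"
  assumes "p > 0"
    and "\<And>k h a b. k < m \<Longrightarrow> a < p \<Longrightarrow> b < p \<Longrightarrow> 0 \<le> w k h a b"
    and "\<And>k z. k < m \<Longrightarrow> z < p \<Longrightarrow> 0 \<le> \<mu> k z"
    and "\<And>k h a b. k < m \<Longrightarrow> e k h a b < p"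
    and "\<And>k h z. k < m \<Longrightarrow> z < p \<Longrightarrow>
      \<mu> k z \<le> (\<Sum>a<p. \<Sum>b<p. if e k h a b = z then w k h a b else 0)"
    and "t < p"
  shows "mod_conv p \<mu> m t \<le> (\<Sum>av\<in>vecs m p. \<Sum>bv\<in>vecs m p.
     if (\<Sum>k<m. e k (trunc k av) (av k) (bv k)) mod p = t
     then \<Prod>k<m. w k (trunc k av) (av k) (bv k) else 0)"
  using assms(2-)
proof (induction m arbitrary: t)
  case 0
  then show ?case by (simp add: vecs_def)
next
  case (Suc m)
  define W where "W av bv = (\<Prod>k<m. w k (trunc k av) (av k) (bv k))" for av bv
  define S where "S av bv = (\<Sum>k<m. e k (trunc k av) (av k) (bv k))" for av bv
  have W0: "0 \<le> W av bv" if "av \<in> vecs m p" "bv \<in> vecs m p" for av bv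
    unfolding W_def using that Suc.prems(1)
    by (intro prod_nonneg) (auto simp: vecs_def PiE_def Pi_def)
  have ev: "(S av bv + z) mod p = t \<longleftrightarrow> S av bv mod p = (t + (p - z)) mod p" if "z < p" for av bv z
  proof -
    have "S av bv mod p = (t + (p - z)) mod p \<longleftrightarrow> [S av bv + z = (t + (p - z)) + z] (mod p)"
      unfolding cong_add_rcancel_nat by (simp add: cong_def)
    also have "(t + (p - z)) + z = t + p" using that by simp
    finally show ?thesis using Suc.prems(5) by (simp add: cong_def)
  qed
  have "mod_conv p \<mu> (Suc m) t \<le> (\<Sum>z<p. \<mu> m z * (\<Sum>av\<in>vecs m p. \<Sum>bv\<in>vecs m p.
     if S av bv mod p = (t + (p - z)) mod p then W av bv else 0))"
    unfolding mod_conv.simps S_def W_def using assms(1) Suc.prems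
    by (intro sum_mono mult_left_mono Suc.IH) auto
  also have "\<dots> = (\<Sum>av\<in>vecs m p. \<Sum>bv\<in>vecs m p. \<Sum>z<p.
      (if S av bv mod p = (t + (p - z)) mod p then W av bv else 0) * \<mu> m z)"
    by (simp add: sum_distrib_left sum_distrib_right sum.swap[of _ "{..<p}" "vecs m p"] mult.commute)
  also have "\<dots> \<le> (\<Sum>av\<in>vecs m p. \<Sum>bv\<in>vecs m p. \<Sum>z<p.
      (if S av bv mod p = (t + (p - z)) mod p then W av bv else 0) *
      (\<Sum>a<p. \<Sum>b<p. if e m (trunc m av) a b = z then w m (trunc m av) a b else 0))"
    using W0 Suc.prems(4) by (intro sum_mono mult_left_mono) auto
  also have "\<dots> = (\<Sum>av\<in>vecs m p. \<Sum>bv\<in>vecs m p. \<Sum>a<p. \<Sum>b<p.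
      if (S av bv + e m (trunc m av) a b) mod p = t then W av bv * w m (trunc m av) a b else 0)"
  proof (rule sum.cong[OF refl], rule sum.cong[OF refl])
    fix av bv
    have "(\<Sum>z<p. (if S av bv mod p = (t + (p - z)) mod p then W av bv else 0) *
      (\<Sum>a<p. \<Sum>b<p. if e m (trunc m av) a b = z then w m (trunc m av) a b else 0)) =
      (\<Sum>z<p. \<Sum>a<p. \<Sum>b<p. if e m (trunc m av) a b = z then
         (if (S av bv + z) mod p = t then W av bv * w m (trunc m av) a b else 0) else 0)"
      unfolding sum_distrib_left by (intro sum.cong refl) (auto simp: ev)
    also have "\<dots> = (\<Sum>a<p. \<Sum>b<p. \<Sum>z<p. if e m (trunc m av) a b = z then
         (if (S av bv + z) mod p = t then W av bv * w m (trunc m av) a b else 0) else 0)"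
      by (rule trans[OF sum.swap], rule sum.cong[OF refl], rule sum.swap)
    also have "\<dots> = (\<Sum>a<p. \<Sum>b<p.
        if (S av bv + e m (trunc m av) a b) mod p = t then W av bv * w m (trunc m av) a b else 0)"
      using Suc.prems(3) by (intro sum.cong refl) (simp add: sum.delta)
    finally show "(\<Sum>z<p. (if S av bv mod p = (t + (p - z)) mod p then W av bv else 0) *
      (\<Sum>a<p. \<Sum>b<p. if e m (trunc m av) a b = z then w m (trunc m av) a b else 0)) =
      (\<Sum>a<p. \<Sum>b<p. if (S av bv + e m (trunc m av) a b) mod p = t then W av bv * w m (trunc m av) a b else 0)" .
  qed
  also have "\<dots> = (\<Sum>av\<in>vecs (Suc m) p. \<Sum>bv\<in>vecs (Suc m) p.
     if (\<Sum>k<Suc m. e k (trunc k av) (av k) (bv k)) mod p = t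
     then \<Prod>k<Suc m. w k (trunc k av) (av k) (bv k) else 0)"
    by (simp add: sum_vecs_Suc S_def W_def sum.swap[of _ "{..<p}" "vecs m p"] cong: if_cong)
  finally show ?case .
qed

section \<open>Counting Alice's input vectors\<close>

lemma card_vecs: "card (vecs N p) = p ^ N"
  by (simp add: vecs_def card_PiE)

lemma card_vecs_fixed:
  assumes "i < N" "u < p" shows "p * card {xv \<in> vecs N p. xv i = u} = p ^ N"
proof -
  have "{xv \<in> vecs N p. xv i = u} = PiE {..<N} (\<lambda>k. if k = i then {u} else {..<p})"
    using assms by (auto simp: vecs_def PiE_def Pi_def split: if_splits)
  then have "card {xv \<in> vecs N p. xv i = u} = (\<Prod>k<N. if k = i then 1 else p)"
    by (simp add: card_PiE if_distrib cong: if_cong)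
  also have "\<dots> = (\<Prod>k\<in>{..<N} - {i}. if k = i then 1 else p)"
    using assms by (subst prod.remove[of _ i]) auto
  also have "\<dots> = p ^ (N - 1)" using assms by simp
  finally show ?thesis using assms by (simp add: power_eq_if)
qed

section \<open>Fano's inequality and the inverse of Tp\<close>

lemma Tp_altdef: "Tp p x = - x * log 2 x - (1 - x) * log 2 (1 - x) + (1 - x) * log 2 (real p - 1)"
  by (simp add: Tp_def bin_entropy_def)

lemma continuous_on_Tp:
  assumes "p \<ge> 2" shows "continuous_on {1 / real p..1} (Tp p)"
proof (rule continuous_on_eq_continuous_within[THEN iffD2], rule ballI)
  fix x assume x: "x \<in> {1 / real p..1}"
  have x0: "x > 0" using x assms by (auto intro: less_le_trans[of 0 "1 / real p"])
  show "continuous (at x within {1 / real p..1}) (Tp p)"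
  proof (cases "x = 1")
    case False
    have "isCont (\<lambda>x. - x * log 2 x - (1 - x) * log 2 (1 - x) + (1 - x) * log 2 (real p - 1)) x"
      using x x0 False by (intro continuous_intros) auto
    then show ?thesis unfolding Tp_altdef[abs_def] by (rule continuous_at_imp_continuous_at_within)
  next
    \<comment> \<open>Only the right endpoint is delicate: there
      \<open>(1 - x) * log 2 (1 - x)\<close> tends to 0, its value at \<open>x = 1\<close>.\<close>
    case True
    have "((\<lambda>x. - x * log 2 x - (1 - x) * log 2 (1 - x) + (1 - x) * log 2 (real p - 1)) \<longlongrightarrow> 0) (at_left 1)"
      unfolding log_def by real_asymp
    then have "(Tp p \<longlongrightarrow> Tp p 1) (at 1 within {..<1})"
      unfolding Tp_altdef[abs_def] by simp
    moreover have "at 1 within {1 / real p..1} = at_left (1::real)"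
      using assms by (intro at_within_Icc_at_left) auto
    ultimately show ?thesis unfolding continuous_within True by simp
  qed
qed

lemma Tp_strict_antimono:
  assumes "p \<ge> 2" "1 / real p \<le> x" "x < y" "y \<le> 1"
  shows "Tp p y < Tp p x"
proof (rule DERIV_neg_imp_decreasing_open[OF assms(3)])
  show "continuous_on {x..y} (Tp p)"
    by (rule continuous_on_subset[OF continuous_on_Tp[OF assms(1)]]) (use assms in auto)
  fix z assume z: "x < z" "z < y"
  have p: "real p \<ge> 2" using assms by simp
  have z1: "1 / real p < z" "z < 1" using z assms by auto
  have z0: "0 < z" using z1 p by (auto intro: less_trans[of 0 "1 / real p"])
  have "((\<lambda>x. (- x * ln x - (1 - x) * ln (1 - x) + (1 - x) * ln (real p - 1)) / ln 2)
      has_real_derivative (ln (1 - z) - ln z - ln (real p - 1)) / ln 2) (at z)"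
    using z0 z1 by (auto intro!: derivative_eq_intros)
  moreover have "Tp p = (\<lambda>x. (- x * ln x - (1 - x) * ln (1 - x) + (1 - x) * ln (real p - 1)) / ln 2)"
    by (simp add: fun_eq_iff Tp_altdef log_def diff_divide_distrib add_divide_distrib)
  moreover have "(ln (1 - z) - ln z - ln (real p - 1)) / ln 2 = log 2 (1 - z) - log 2 (z * (real p - 1))"
    using z0 z1 p by (simp add: log_def ln_mult diff_divide_distrib add_divide_distrib)
  \<comment> \<open>This is where \<open>1 / p < z\<close> enters: it says
    \<open>1 - z < z * (p - 1)\<close>.\<close>
  moreover have "log 2 (1 - z) < log 2 (z * (real p - 1))"
    using z0 z1 p by (subst log_less_cancel_iff) (auto simp: field_simps)
  ultimately show "\<exists>l. (Tp p has_real_derivative l) (at z) \<and> l < 0" by auto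
qed

lemma Tp_at_inverse:
  assumes "p \<ge> 2" shows "Tp p (1 / real p) = log 2 (real p)"
proof -
  have p: "real p \<ge> 2" using assms by simp
  have 1: "1 - 1 / real p = (real p - 1) / real p" using p by (simp add: field_simps)
  have "Tp p (1 / real p) = 1 / real p * log 2 (real p) + (real p - 1) / real p * log 2 (real p)"
    unfolding Tp_altdef 1 using p by (simp add: log_divide algebra_simps)
  also have "\<dots> = log 2 (real p)" using p by (simp add: field_simps)
  finally show ?thesis .
qed

text \<open>The intermediate value theorem gives existence and strict monotonicity uniqueness, so
  the definite description in \<open>Tp_inv\<close> is well defined.\<close>

lemma Tp_inv_props:
  assumes "p \<ge> 2" "0 \<le> t" "t \<le> log 2 (real p)"
  shows "1 / real p \<le> Tp_inv p t" "Tp_inv p t \<le> 1" "Tp p (Tp_inv p t) = t"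
proof -
  have "\<exists>x. 1 / real p \<le> x \<and> x \<le> 1 \<and> Tp p x = t"
    by (rule IVT2') (use assms continuous_on_Tp Tp_at_inverse in \<open>auto simp: Tp_altdef\<close>)
  then obtain x where x: "1 / real p \<le> x \<and> x \<le> 1 \<and> Tp p x = t" by blast
  have "\<exists>!x. 1 / real p \<le> x \<and> x \<le> 1 \<and> Tp p x = t"
  proof (rule ex1I)
    show "1 / real p \<le> x \<and> x \<le> 1 \<and> Tp p x = t" by (rule x)
    fix y assume y: "1 / real p \<le> y \<and> y \<le> 1 \<and> Tp p y = t"
    show "y = x"
      using x y Tp_strict_antimono[OF assms(1), of x y] Tp_strict_antimono[OF assms(1), of y x]
      by (cases x y rule: linorder_cases) auto
  qed
  from theI'[OF this] show "1 / real p \<le> Tp_inv p t" "Tp_inv p t \<le> 1" "Tp p (Tp_inv p t) = t"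
    unfolding Tp_inv_def by auto
qed

text \<open>Gibbs' inequality, against the channel that is correct with probability \<open>s\<close> and uniform on
  the wrong values otherwise.\<close>
lemma mutual_info_ge:
  assumes p: "p \<ge> 2" and J0: "\<And>u v. u < p \<Longrightarrow> v < p \<Longrightarrow> 0 \<le> J u v"
    and marg: "\<And>u. u < p \<Longrightarrow> (\<Sum>v<p. J u v) = 1 / real p"
    and s: "1 / real p \<le> s" "s < 1" and Js: "s \<le> (\<Sum>u<p. J u u)"
  shows "log 2 (real p) - Tp p s \<le> mutual_info p J"
proof -
  have pr: "real p \<ge> 2" using p by simp
  have s0: "s > 0" using s(1) pr by (auto intro: less_le_trans[of 0 "1 / real p"])
  define d where "d = (1 - s) / (real p - 1)"
  have d0: "d > 0" unfolding d_def using s pr by simp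
  define K where "K u v = (if u = v then s else d)" for u v :: nat
  have K0: "K u v > 0" for u v by (simp add: K_def s0 d0)
  define c where "c v = (\<Sum>u<p. J u v)" for v
  have c0: "0 \<le> c v" if "v < p" for v unfolding c_def using J0 that by (intro sum_nonneg) auto
  have tot: "(\<Sum>u<p. \<Sum>v<p. J u v) = 1" using marg pr by simp
  then have ctot: "(\<Sum>v<p. c v) = 1" unfolding c_def by (subst sum.swap)
  have Ksum: "(\<Sum>u<p. K u v) = 1" if "v < p" for v
  proof -
    have "(\<Sum>u<p. K u v) = (\<Sum>u<p. d + (if u = v then s - d else 0))"
      by (intro sum.cong refl) (simp add: K_def)
    also have "\<dots> = real p * d + (s - d)" using that by (simp add: sum.distrib)
    also have "\<dots> = (real p - 1) * d + s" by (simp add: algebra_simps)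
    also have "\<dots> = 1" using pr by (simp add: d_def)
    finally show ?thesis .
  qed
  \<comment> \<open>The pointwise form of Gibbs' inequality, from \<open>ln x \<le> x - 1\<close>.
    The correction terms cancel in the sum because \<open>J u v\<close> and
    \<open>c v * K u v\<close> both have total mass 1.\<close>
  have term_ge: "J u v * (log 2 (real p) + log 2 (K u v)) + (J u v - c v * K u v) / ln 2 \<le>
      (if J u v > 0 then J u v * log 2 (J u v / ((\<Sum>v'<p. J u v') * (\<Sum>u'<p. J u' v))) else 0)"
    if uv: "u < p" "v < p" for u v
  proof (cases "J u v > 0")
    case True
    have "J u v \<le> c v" unfolding c_def using uv J0 by (intro member_le_sum) auto
    then have cv: "c v > 0" using True by simp
    have "ln (c v * K u v / J u v) \<le> c v * K u v / J u v - 1"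
      using cv K0 True by (intro ln_le_minus_one) simp
    then have "J u v * ln (c v * K u v / J u v) \<le> c v * K u v - J u v"
      using True by (simp add: field_simps)
    then have "J u v - c v * K u v \<le> J u v * ln (J u v / (c v * K u v))"
      using cv K0[of u v] True by (simp add: ln_div ln_mult algebra_simps)
    from divide_right_mono[OF this, of "ln 2"]
    have "(J u v - c v * K u v) / ln 2 \<le> J u v * (ln (J u v / (c v * K u v)) / ln 2)" by simp
    then have "(J u v - c v * K u v) / ln 2 \<le> J u v * (log 2 (J u v) - log 2 (c v) - log 2 (K u v))"
      using cv K0[of u v] True 
      by (simp add: log_def ln_div ln_mult diff_divide_distrib add_divide_distrib diff_diff_eq)
    moreover have eq: "log 2 (J u v / ((\<Sum>v'<p. J u v') * (\<Sum>u'<p. J u' v))) = log 2 (J u v) - log 2 (c v) + log 2 (real p)"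
      unfolding marg[OF uv(1)] c_def[symmetric] using True cv pr by (simp add: log_divide log_mult)
    ultimately show ?thesis unfolding eq using True by (simp add: algebra_simps)
  next
    case False
    then have "J u v = 0" using J0[OF uv] by simp
    then show ?thesis using c0[OF uv(2)] K0[of u v] by simp
  qed
  have "(\<Sum>u<p. \<Sum>v<p. J u v * (log 2 (real p) + log 2 (K u v)) + (J u v - c v * K u v) / ln 2) \<le> mutual_info p J"
    unfolding mutual_info_def by (intro sum_mono term_ge) auto
  moreover have "(\<Sum>u<p. \<Sum>v<p. c v * K u v) = 1"
    using Ksum ctot by (subst sum.swap) (simp add: sum_distrib_left[symmetric])
  then have "(\<Sum>u<p. \<Sum>v<p. (J u v - c v * K u v) / ln 2) = 0"
    using tot by (simp add: sum_divide_distrib[symmetric] sum_subtractf)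
  moreover have "(\<Sum>u<p. \<Sum>v<p. J u v * log 2 (real p)) = log 2 (real p)"
    using tot by (simp add: sum_distrib_right[symmetric])
  moreover have "(\<Sum>u<p. \<Sum>v<p. J u v * log 2 (K u v)) =
      (\<Sum>u<p. J u u) * log 2 s + (1 - (\<Sum>u<p. J u u)) * log 2 d"
  proof -
    have "(\<Sum>u<p. \<Sum>v<p. J u v * log 2 (K u v)) =
       (\<Sum>u<p. \<Sum>v<p. J u v * log 2 d + (if u = v then J u v * (log 2 s - log 2 d) else 0))"
      by (intro sum.cong refl) (simp add: K_def algebra_simps)
    also have "\<dots> = (\<Sum>u<p. \<Sum>v<p. J u v * log 2 d) + (\<Sum>u<p. J u u * (log 2 s - log 2 d))"
      by (simp add: sum.distrib)
    also have "\<dots> = log 2 d + (\<Sum>u<p. J u u) * (log 2 s - log 2 d)"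
      using tot by (simp add: sum_distrib_right[symmetric])
    finally show ?thesis by (simp add: algebra_simps)
  qed
  \<comment> \<open>The estimate increases with the success probability because
    \<open>d \<le> s\<close>, a form of \<open>1 / p \<le> s\<close>; so the true success
    probability may be lowered to \<open>s\<close>.\<close>
  moreover have "s * log 2 s + (1 - s) * log 2 d \<le> (\<Sum>u<p. J u u) * log 2 s + (1 - (\<Sum>u<p. J u u)) * log 2 d"
  proof -
    have "1 \<le> s * real p" using s(1) pr by (simp add: field_simps)
    then have "d \<le> s" unfolding d_def using pr by (simp add: field_simps)
    then have "log 2 d \<le> log 2 s" using d0 s0 by simp
    then have "0 \<le> ((\<Sum>u<p. J u u) - s) * (log 2 s - log 2 d)" using Js by simp
    then show ?thesis by (simp add: algebra_simps)
  qed
  moreover have "s * log 2 s + (1 - s) * log 2 d = - Tp p s"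
    unfolding Tp_altdef d_def using s pr by (simp add: log_divide algebra_simps)
  ultimately show ?thesis by (simp add: sum.distrib distrib_left)
qed

text \<open>If \<open>S\<close> exceeded the bound, each of the \<open>N\<close> mutual informations
  would be larger than \<open>log 2 p / N\<close>, contradicting \<open>IC\<close>.\<close>

lemma guessing_bound:
  assumes p: "p \<ge> 2" and N: "N \<ge> 1"
    and J0: "\<And>i u v. i < N \<Longrightarrow> u < p \<Longrightarrow> v < p \<Longrightarrow> 0 \<le> J i u v"
    and marg: "\<And>i u. i < N \<Longrightarrow> u < p \<Longrightarrow> (\<Sum>v<p. J i u v) = 1 / real p"
    and S: "\<And>i. i < N \<Longrightarrow> S \<le> (\<Sum>u<p. J i u u)"
    and IC: "(\<Sum>i<N. mutual_info p (J i)) \<le> log 2 (real p)"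
  shows "S \<le> Tp_inv p ((real N - 1) / real N * log 2 (real p))"
proof (rule ccontr)
  define t where "t = (real N - 1) / real N * log 2 (real p)"
  define \<tau> where "\<tau> = Tp_inv p t"
  have pr: "real p \<ge> 2" using p by simp
  have lp: "log 2 (real p) > 0" using pr by simp
  have "0 \<le> t" using N lp by (simp add: t_def)
  moreover have "t \<le> log 2 (real p)" unfolding t_def using N lp by (simp add: field_simps)
  ultimately have \<tau>: "1 / real p \<le> \<tau>" "\<tau> \<le> 1" "Tp p \<tau> = t"
    using Tp_inv_props[OF p] unfolding \<tau>_def by auto
  assume "\<not> S \<le> Tp_inv p ((real N - 1) / real N * log 2 (real p))"
  then have S\<tau>: "\<tau> < S" by (simp add: \<tau>_def t_def)
  have "(\<Sum>u<p. J 0 u u) \<le> (\<Sum>u<p. \<Sum>v<p. J 0 u v)"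
    using J0 N by (intro sum_mono member_le_sum) auto
  also have "\<dots> = 1" using marg N pr by simp
  finally have S1: "S \<le> 1" using S[of 0] N by simp
  \<comment> \<open>A point strictly below \<open>S\<close> is taken because
    \<open>mutual_info_ge\<close> needs a value below 1, whereas \<open>S\<close> may equal
    1.\<close>
  define s where "s = (S + \<tau>) / 2"
  have s: "\<tau> < s" "s < S" using S\<tau> by (auto simp: s_def)
  have "real N * (log 2 (real p) - Tp p s) = (\<Sum>i<N. log 2 (real p) - Tp p s)" by simp
  also have "\<dots> \<le> (\<Sum>i<N. mutual_info p (J i))"
  proof (rule sum_mono)
    fix i assume "i \<in> {..<N}"
    then show "log 2 (real p) - Tp p s \<le> mutual_info p (J i)"
      using J0 marg S[of i] s S1 \<tau> by (intro mutual_info_ge[OF p]) auto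
  qed
  also note IC
  finally have "t \<le> Tp p s" unfolding t_def using N by (simp add: field_simps)
  moreover have "Tp p s < Tp p \<tau>" using s S1 \<tau> by (intro Tp_strict_antimono[OF p]) auto
  ultimately show False using \<tau>(3) by simp
qed

section \<open>The bound\<close>

lemma E_val_nonneg:
  assumes "is_box p P" "p > 0" "x < p" "y < p" shows "0 \<le> E_val p P f x y j"
  unfolding E_val_def using assms
  by (intro sum_nonneg) (auto simp: is_box_def nat_less_iff)

lemma nu_bounds:
  assumes "is_box p P" "p > 0"
  shows "0 \<le> nu p P f j" "x < p \<Longrightarrow> y < p \<Longrightarrow> nu p P f j \<le> E_val p P f x y j"
proof -
  define D where "D = {E_val p P f x y j | x y. x < p \<and> y < p}"
  have "D = (\<lambda>(x, y). E_val p P f x y j) ` ({..<p} \<times> {..<p})" unfolding D_def by auto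
  then have fin: "finite D" by simp
  have ne: "D \<noteq> {}" unfolding D_def using assms(2) by auto
  have nu: "nu p P f j = Min D" by (simp add: nu_def D_def)
  show "0 \<le> nu p P f j"
    unfolding nu using fin ne E_val_nonneg[OF assms] by (auto simp: D_def)
  show "nu p P f j \<le> E_val p P f x y j" if "x < p" "y < p"
    unfolding nu by (rule Min_le[OF fin]) (use that in \<open>auto simp: D_def\<close>)
qed

text \<open>The noise of a box is \<open>b - a + f x y\<close>, and \<open>E_val\<close> is the
  probability that it equals \<open>j\<close> modulo \<open>p\<close>. A sign is its own inverse, so
  signed noise \<open>z\<close> means noise \<open>\<sigma> * z\<close>.\<close>

lemma noise_probability_ge:
  assumes P: "is_box p P" and p: "p > 0" and xy: "x < p" "y < p" and z: "z < p"
    and \<sigma>: "\<sigma> = 1 \<or> \<sigma> = (-1 :: int)"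
  shows "nu p P f (nat ((\<sigma> * int z) mod int p)) \<le>
    (\<Sum>a<p. \<Sum>b<p. if nat ((\<sigma> * (int b - int a + int (f x y))) mod int p) = z then P a b x y else 0)"
proof -
  define j where "j = nat ((\<sigma> * int z) mod int p)"
  have ij: "int j = (\<sigma> * int z) mod int p" unfolding j_def using p by simp
  have "nu p P f j \<le> E_val p P f x y j" using nu_bounds[OF P p] xy by blast
  also have "\<dots> \<le> (\<Sum>a<p. \<Sum>b<p. if nat ((\<sigma> * (int b - int a + int (f x y))) mod int p) = z then P a b x y else 0)"
    unfolding E_val_def
  proof (rule sum_mono)
    fix a assume a: "a \<in> {..<p}"
    define b where "b = nat ((int a - int (f x y) + int j) mod int p)"
    have ib: "int b = (int a - int (f x y) + int j) mod int p" unfolding b_def using p by simp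
    then have "int b < int p" using p by simp
    then have b: "b < p" by simp
    have "[int b - int a + int (f x y) = (int a - int (f x y) + \<sigma> * int z) - int a + int (f x y)] (mod int p)"
      unfolding ib ij by (intro cong_add cong_diff cong_refl) (simp add: cong_def mod_simps)
    then have "[\<sigma> * (int b - int a + int (f x y)) = \<sigma> * (\<sigma> * int z)] (mod int p)"
      by (intro cong_mult cong_refl) simp
    also have "\<sigma> * (\<sigma> * int z) = int z" using \<sigma> by auto
    finally have "(\<sigma> * (int b - int a + int (f x y))) mod int p = int z"
      using z by (simp add: cong_def)
    then have "P a b x y = (if nat ((\<sigma> * (int b - int a + int (f x y))) mod int p) = z then P a b x y else 0)"
      by simp
    also have "\<dots> \<le> (\<Sum>b<p. if nat ((\<sigma> * (int b - int a + int (f x y))) mod int p) = z then P a b x y else 0)"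
      by (rule member_le_sum) (use b a P xy in \<open>auto simp: is_box_def\<close>)
    finally show "P a (nat ((int a - int (f x y) + int j) mod int p)) x y \<le>
      (\<Sum>b<p. if nat ((\<sigma> * (int b - int a + int (f x y))) mod int p) = z then P a b x y else 0)"
      unfolding b_def .
  qed
  finally show ?thesis unfolding j_def .
qed

text \<open>A code whose decoder reads \<open>r\<close> products, run on simulated products, gives a
  protocol in which Bob succeeds with probability at least the left-hand side. The code is demanded
  for every \<phi> because the offset of the simulated products is known only after \<open>f\<close>
  has been linearised.\<close>

lemma xcode_bound:
  assumes p: "prime p" and f: "\<forall>x y. x < p \<longrightarrow> y < p \<longrightarrow> f x y < p" and D: "Delta p f > 2"
    and P: "is_box p P" and IC: "info_causality p P" and N: "N \<ge> 1" and c: "c < p"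
    and code: "\<And>\<phi>. \<exists>m X Y R Q. xcode \<phi> N m r X Y R Q"
  shows "bound_lhs p (nu p P f) (r * 2 ^ (Delta p f - 2)) c \<in> \<real> \<and>
    Re (bound_lhs p (nu p P f) (r * 2 ^ (Delta p f - 2)) c) \<le> Tp_inv p ((real N - 1) / real N * log 2 (real p))"
proof -
  define M :: nat where "M = 2 ^ (Delta p f - 2)"
  have M0: "M > 0" by (simp add: M_def)
  have p0: "p > 0" and p2: "p \<ge> 2" using p prime_gt_0_nat prime_ge_2_nat by auto
  obtain \<sigma> :: "nat \<Rightarrow> int" and s t :: "nat \<Rightarrow> nat" and \<kappa> C :: int where
    \<sigma>: "\<And>l. l < M \<Longrightarrow> \<sigma> l = 1 \<or> \<sigma> l = -1" and cM: "2 * card {l \<in> {..<M}. \<sigma> l = 1} = M"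
    and C: "\<not> int p dvd C"
    and lin: "\<And>x. [(\<Sum>l<M. \<sigma> l * int (f ((x + s l) mod p) ((1 + t l) mod p)))
             - (\<Sum>l<M. \<sigma> l * int (f ((x + s l) mod p) ((0 + t l) mod p)))
             = \<kappa> + C * int x] (mod int p)"
    by (rule linearising_shifts[OF p f D, folded M_def]) blast

  \<comment> \<open>Simulating products by boxes\<close>
  have "coprime (int p) C" using C p by (intro prime_imp_coprime) auto
  then obtain Ci where Ci: "[C * Ci = 1] (mod int p)"
    using cong_solve_coprime_int[of C "int p"] by (auto simp: coprime_commute)
  \<comment> \<open>Multiplying Alice's input by the inverse \<open>Ci\<close> of \<open>C\<close>
    normalises the slope to 1.\<close>
  define xt where "xt z = nat ((Ci * z) mod int p)" for z
  define F where "F x y = (\<Sum>l<M. \<sigma> l * int (f ((x + s l) mod p) ((y + t l) mod p)))" for x y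
  define \<phi> where "\<phi> z = F (xt z) 0" for z
  \<comment> \<open>The constant \<kappa> is multiplied by Bob's bit only, so he can remove it
    himself; \<phi> is the value at \<open>y = 0\<close>.\<close>
  have F: "[F (xt z) y = \<phi> z + int y * (\<kappa> + z)] (mod int p)" if "y \<le> 1" for y z
  proof (cases "y = 0")
    case False
    then have y: "y = 1" using that by simp
    have "[C * int (xt z) = C * (Ci * z)] (mod int p)"
      unfolding xt_def using p0 by (intro cong_mult cong_refl) (simp add: cong_def)
    also have "[C * (Ci * z) = 1 * z] (mod int p)"
      unfolding mult.assoc[symmetric] by (intro cong_mult Ci cong_refl)
    finally have "[\<kappa> + C * int (xt z) = \<kappa> + z] (mod int p)" by (intro cong_add cong_refl) simp
    with lin[of "xt z"] have "[F (xt z) 1 - F (xt z) 0 = \<kappa> + z] (mod int p)"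
      unfolding F_def by (rule cong_trans)
    then show ?thesis unfolding y \<phi>_def by (simp add: cong_iff_dvd_diff algebra_simps)
  qed (simp add: \<phi>_def)

  \<comment> \<open>The protocol\<close>
  obtain m X Y R Q where xc: "xcode \<phi> N m r X Y R Q" using code by blast
  have X: "X t xv \<alpha> = X t xv \<alpha>'" if "\<And>s. s < t \<Longrightarrow> \<alpha> s = \<alpha>' s" for t xv \<alpha> \<alpha>'
    using xc that unfolding xcode_def by blast
  have Y: "Y t i \<le> 1" for t i using xc unfolding xcode_def by blast
  have R: "R i \<subseteq> {..<m}" "card (R i) = r" if "i < N" for i
    using xc that unfolding xcode_def by blast+
  have Q: "Q xv \<alpha> = xv i + (\<Sum>t\<in>R i. \<alpha> t - int (Y t i) * X t xv \<alpha> - \<phi> (X t xv \<alpha>))"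
    if "i < N" for i xv \<alpha> using xc that unfolding xcode_def by blast
  \<comment> \<open>The signed sum of the outputs of a block of \<open>M\<close> boxes serves as the
    output of one simulated product; physical box \<open>k\<close> is number \<open>k mod M\<close>
    of block \<open>k div M\<close>.\<close>
  define al where "al h t = (\<Sum>l<M. \<sigma> l * int (h (t * M + l)))" for h :: "nat \<Rightarrow> nat" and t
  define xi where "xi xv = (\<lambda>i. int (xv i))" for xv :: "nat \<Rightarrow> nat"
  define Ain where "Ain k xv h = (xt (X (k div M) (xi xv) (al h)) + s (k mod M)) mod p" for k xv h
  define Bin where "Bin k i = (Y (k div M) i + t (k mod M)) mod p" for k i
  define A where "A = (\<lambda>k xv (\<rho>::nat) h. Ain k xv h)"
  define Qm where "Qm = (\<lambda>xv (\<rho>::nat) h. nat (Q (xi xv) (al h) mod int p))"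
  define B where "B = (\<lambda>k i (q::nat) (\<rho>::nat) (h :: nat \<Rightarrow> nat). Bin k i)"
  \<comment> \<open>Besides removing his own outputs and the terms in \<kappa>, Bob subtracts
    \<open>c\<close>. This makes him right exactly when the total noise is \<open>-c\<close>, so the
    decoders for the different \<open>c\<close> yield the whole family of bounds.\<close>
  define Dm where "Dm = (\<lambda>i q (\<rho>::nat) h.
     nat ((int q - (\<Sum>t\<in>R i. al h t + int (Y t i) * \<kappa>) - int c) mod int p))"
  define n where "n = m * M"
  have Ap: "Ain k xv h < p" and Bp: "Bin k i < p" for k xv h i
    using p0 by (auto simp: Ain_def Bin_def)
  define w where "w xv i k h a b = P a b (Ain k xv h) (Bin k i)" for xv i k h a b
  define e where "e xv i k h a b = (if k div M \<in> R i
      then nat ((\<sigma> (k mod M) * (int b - int a + int (f (Ain k xv h) (Bin k i)))) mod int p) else 0)"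
    for xv i k h a b
  define \<mu> where "\<mu> i k z = (if k div M \<in> R i then nu p P f (nat ((\<sigma> (k mod M) * int z) mod int p))
      else if z = 0 then 1 else 0)" for i k z
  define t0 where "t0 = (p - c) mod p"
  have t0: "t0 < p" using p0 by (simp add: t0_def)
  have al_trunc: "al (trunc k h) u = al h u" if "Suc u * M \<le> k" for k h u
    unfolding al_def by (intro sum.cong refl) (use that in \<open>auto simp: trunc_def\<close>)
  \<comment> \<open>Modulo \<open>p\<close>, Bob's guess is \<open>xv i\<close> minus the total
    noise minus \<open>c\<close>; \<open>t0\<close> represents \<open>-c\<close>.\<close>
  have guess: "Dm i (Qm xv 0 (trunc n av) mod p) 0 (trunc n bv) mod p = xv i \<longleftrightarrow>
      (\<Sum>k<n. e xv i k (trunc k av) (av k) (bv k)) mod p = t0"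
    if i: "i < N" and xv: "xv \<in> vecs N p" for i xv av bv
  proof -
    define \<alpha> where "\<alpha> = al av"
    define \<beta> where "\<beta> = al bv"
    define x where "x u = X u (xi xv) \<alpha>" for u
    have le: "Suc u * M \<le> n" if "u \<in> R i" for u
      unfolding n_def using R(1)[OF i] that by (intro mult_right_mono) auto
    \<comment> \<open>The input of block \<open>u\<close> depends on earlier blocks only, and these
      are complete in any history of length at least \<open>u * M\<close>; so all boxes of the block
      simulate the same product input \<open>x u\<close>.\<close>
    have Xtr: "X u (xi xv) (al (trunc k av)) = x u" if "u * M \<le> k" for u k
      unfolding x_def \<alpha>_def
    proof (rule X, rule al_trunc)
      fix v assume "v < u"
      then have "Suc v * M \<le> u * M" by (intro mult_right_mono) auto
      then show "Suc v * M \<le> k" using that by simp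
    qed
    define E where "E = (\<Sum>k<n. e xv i k (trunc k av) (av k) (bv k))"
    define G where "G = (\<Sum>u\<in>R i. \<beta> u - \<alpha> u + \<phi> (x u) + int (Y u i) * (\<kappa> + x u))"
    have "[int E = (\<Sum>k<n. if k div M \<in> R i then
        \<sigma> (k mod M) * (int (bv k) - int (av k) + int (f (Ain k xv (trunc k av)) (Bin k i))) else 0)] (mod int p)"
      unfolding E_def of_nat_sum using p0
      by (intro cong_sum) (simp add: e_def cong_def)
    also have "(\<Sum>k<n. if k div M \<in> R i then
        \<sigma> (k mod M) * (int (bv k) - int (av k) + int (f (Ain k xv (trunc k av)) (Bin k i))) else 0) =
        (\<Sum>u<m. if u \<in> R i then \<beta> u - \<alpha> u + F (xt (x u)) (Y u i) else 0)"
      unfolding n_def sum_blocks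
    proof (rule sum.cong[OF refl])
      fix u
      have "Ain (u * M + l) xv (trunc (u * M + l) av) = (xt (x u) + s l) mod p"
        "Bin (u * M + l) i = (Y u i + t l) mod p" if "l < M" for l
        using that Xtr[of u "u * M + l"] by (simp_all add: Ain_def Bin_def)
      then have "(\<Sum>l<M. \<sigma> l * (int (bv (u * M + l)) - int (av (u * M + l)) +
          int (f (Ain (u * M + l) xv (trunc (u * M + l) av)) (Bin (u * M + l) i)))) =
          \<beta> u - \<alpha> u + F (xt (x u)) (Y u i)"
        unfolding \<alpha>_def \<beta>_def al_def F_def
        by (simp add: sum.distrib[symmetric] sum_subtractf[symmetric] distrib_left right_diff_distrib)
      then show "(\<Sum>l<M. if (u * M + l) div M \<in> R i then
        \<sigma> ((u * M + l) mod M) * (int (bv (u * M + l)) - int (av (u * M + l)) +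
          int (f (Ain (u * M + l) xv (trunc (u * M + l) av)) (Bin (u * M + l) i))) else 0) =
        (if u \<in> R i then \<beta> u - \<alpha> u + F (xt (x u)) (Y u i) else 0)"
        by (cases "u \<in> R i") simp_all
    qed
    also have "\<dots> = (\<Sum>u\<in>{..<m} \<inter> R i. \<beta> u - \<alpha> u + F (xt (x u)) (Y u i))"
      by (simp add: sum.inter_restrict)
    also have "{..<m} \<inter> R i = R i" using R(1)[OF i] by auto
    also have "[(\<Sum>u\<in>R i. \<beta> u - \<alpha> u + F (xt (x u)) (Y u i)) = G] (mod int p)"
      unfolding G_def add.assoc
      by (intro cong_sum cong_add cong_refl) (use F Y in \<open>auto simp: add.assoc\<close>)
    finally have EG: "[int E = G] (mod int p)" .
    have Qeq: "Q (xi xv) (al (trunc n av)) - (\<Sum>u\<in>R i. al (trunc n bv) u + int (Y u i) * \<kappa>) = int (xv i) - G"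
    proof -
      have "Q (xi xv) (al (trunc n av)) =
          int (xv i) + (\<Sum>u\<in>R i. \<alpha> u - int (Y u i) * x u - \<phi> (x u))"
        unfolding Q[OF i]
      proof (intro arg_cong2[where f = "(+)"] sum.cong refl)
        fix u assume u: "u \<in> R i"
        have "u * M \<le> n" using le[OF u] by simp
        then show "al (trunc n av) u - int (Y u i) * X u (xi xv) (al (trunc n av)) - \<phi> (X u (xi xv) (al (trunc n av))) =
           \<alpha> u - int (Y u i) * x u - \<phi> (x u)"
          using al_trunc[OF le[OF u]] Xtr by (simp add: \<alpha>_def)
      qed (simp add: xi_def)
      moreover have "(\<Sum>u\<in>R i. al (trunc n bv) u + int (Y u i) * \<kappa>) = (\<Sum>u\<in>R i. \<beta> u + int (Y u i) * \<kappa>)"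
        using al_trunc le by (intro sum.cong refl) (simp add: \<beta>_def)
      ultimately show ?thesis
        by (simp add: G_def sum_subtractf sum.distrib algebra_simps)
    qed
    have xvi: "xv i < p" using xv i by (auto simp: vecs_def)
    define q where "q = Qm xv 0 (trunc n av) mod p"
    have q: "[int q = Q (xi xv) (al (trunc n av))] (mod int p)"
      unfolding q_def Qm_def using p0 by (simp add: cong_def of_nat_mod)
    have "[int q - (\<Sum>u\<in>R i. al (trunc n bv) u + int (Y u i) * \<kappa>) - int c
        = Q (xi xv) (al (trunc n av)) - (\<Sum>u\<in>R i. al (trunc n bv) u + int (Y u i) * \<kappa>) - int c] (mod int p)"
      by (intro cong_diff cong_refl q)
    also have "[Q (xi xv) (al (trunc n av)) - (\<Sum>u\<in>R i. al (trunc n bv) u + int (Y u i) * \<kappa>) - int c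
        = int (xv i) - int E - int c] (mod int p)"
      unfolding Qeq by (intro cong_diff cong_refl cong_sym[OF EG])
    finally have Deq: "(int q - (\<Sum>u\<in>R i. al (trunc n bv) u + int (Y u i) * \<kappa>) - int c) mod int p =
        (int (xv i) - int E - int c) mod int p" by (simp add: cong_def)
    have "Dm i q 0 (trunc n bv) mod p = xv i \<longleftrightarrow> (int (xv i) - int E - int c) mod int p = int (xv i)"
    proof -
      define y where "y = (int (xv i) - int E - int c) mod int p"
      have "0 \<le> y" "y < int p" using p0 by (simp_all add: y_def)
      then have "nat y mod p = xv i \<longleftrightarrow> y = int (xv i)" by (auto simp: nat_less_iff)
      then show ?thesis unfolding Dm_def Deq y_def .
    qed
    also have "\<dots> \<longleftrightarrow> [int (xv i) - int E - int c = int (xv i)] (mod int p)"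
      using xvi by (simp add: cong_def)
    also have "\<dots> \<longleftrightarrow> int p dvd int (E + c)"
    proof -
      have "int (xv i) - int E - int c - int (xv i) = - int (E + c)" by simp
      then show ?thesis unfolding cong_iff_dvd_diff by (simp only: dvd_minus_iff)
    qed
    also have "\<dots> \<longleftrightarrow> [E + c = (p - c) + c] (mod p)"
      using c by (simp add: cong_def dvd_eq_mod_eq_0 flip: of_nat_mod of_nat_add)
    also have "\<dots> \<longleftrightarrow> E mod p = t0"
      unfolding cong_add_rcancel_nat by (simp add: cong_def t0_def)
    finally show ?thesis unfolding q_def E_def .
  qed

  \<comment> \<open>Success probability and conclusion\<close>
  define J where "J = ic_joint p P N n A Qm B Dm (return_pmf 0)"
  define Z where "Z i xv v = (\<Sum>av\<in>vecs n p. \<Sum>bv\<in>vecs n p.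
      if Dm i (Qm xv 0 (trunc n av) mod p) 0 (trunc n bv) mod p = v
      then \<Prod>k<n. w xv i k (trunc k av) (av k) (bv k) else 0)" for i xv v
  have J: "J i u v = 1 / real p ^ N * (\<Sum>xv\<in>{xv \<in> vecs N p. xv i = u}. Z i xv v)" for i u v
    unfolding J_def ic_joint_def Z_def Let_def w_def A_def B_def
    by (simp add: mod_less[OF Ap] mod_less[OF Bp] cong: if_cong)
  have w0: "0 \<le> w xv i k h a b" if "a < p" "b < p" for xv i k h a b
    using P Ap Bp that by (simp add: w_def is_box_def)
  have Z0: "0 \<le> Z i xv v" for i xv v
    unfolding Z_def using w0
    by (intro sum_nonneg) (auto intro!: prod_nonneg simp: vecs_def PiE_def Pi_def)
  have Zsum: "(\<Sum>v<p. Z i xv v) = 1" for i xv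
  proof -
    have "(\<Sum>v<p. Z i xv v) = (\<Sum>av\<in>vecs n p. \<Sum>bv\<in>vecs n p. \<Sum>v<p.
      if Dm i (Qm xv 0 (trunc n av) mod p) 0 (trunc n bv) mod p = v
      then \<Prod>k<n. w xv i k (trunc k av) (av k) (bv k) else 0)"
      unfolding Z_def by (rule trans[OF sum.swap], rule sum.cong[OF refl], rule sum.swap)
    also have "\<dots> = (\<Sum>av\<in>vecs n p. \<Sum>bv\<in>vecs n p. \<Prod>k<n. w xv i k (trunc k av) (av k) (bv k))"
      using p0 by simp
    also have "\<dots> = 1"
      by (rule adaptive_total) (use P Ap Bp in \<open>simp add: w_def is_box_def\<close>)
    finally show ?thesis .
  qed
  define S where "S = mod_conv p (\<mu> 0) n t0"
  \<comment> \<open>Each \<open>R i\<close> has \<open>r\<close> elements, so the convolution equals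
    the left-hand side for every \<open>i\<close>; this also shows that the left-hand side is
    real.\<close>
  have Sb: "bound_lhs p (nu p P f) (r * M) c = complex_of_real (mod_conv p (\<mu> i) n t0)" if "i < N" for i
    unfolding n_def t0_def \<mu>_def
    by (rule bound_lhs_eq_mod_conv[OF p0 c R[OF that] \<sigma> cM])
  have S: "bound_lhs p (nu p P f) (r * M) c = complex_of_real S" using Sb[of 0] N by (simp add: S_def)
  have ZS: "S \<le> Z i xv (xv i)" if i: "i < N" and xv: "xv \<in> vecs N p" for i xv
  proof -
    have "S = mod_conv p (\<mu> i) n t0" using S Sb[OF i] by simp
    also have "\<dots> \<le> (\<Sum>av\<in>vecs n p. \<Sum>bv\<in>vecs n p.
       if (\<Sum>k<n. e xv i k (trunc k av) (av k) (bv k)) mod p = t0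
       then \<Prod>k<n. w xv i k (trunc k av) (av k) (bv k) else 0)"
    proof (rule adaptive_sum_ge[OF p0])
      show "0 \<le> \<mu> i k z" for k z using nu_bounds(1)[OF P p0] by (simp add: \<mu>_def)
      show "e xv i k h a b < p" for k h a b using p0 by (simp add: e_def nat_less_iff)
      show "\<mu> i k z \<le> (\<Sum>a<p. \<Sum>b<p. if e xv i k h a b = z then w xv i k h a b else 0)"
        if "k < n" "z < p" for k h z
      proof (cases "k div M \<in> R i")
        case True
        then show ?thesis
          using noise_probability_ge[OF P p0 Ap Bp \<open>z < p\<close> \<sigma>[OF mod_less_divisor[OF M0]], of f]
          by (simp add: \<mu>_def e_def w_def cong: if_cong)
      next
        \<comment> \<open>An unread box has noise 0 by definition of \<open>e\<close>, so the point
          mass at 0 is its exact law.\<close>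
        case False
        then show ?thesis using P Ap Bp by (auto simp: \<mu>_def e_def w_def is_box_def)
      qed
    qed (use w0 t0 in auto)
    also have "\<dots> = Z i xv (xv i)" unfolding Z_def guess[OF i xv] ..
    finally show ?thesis .
  qed
  have "S \<le> Tp_inv p ((real N - 1) / real N * log 2 (real p))"
  proof (rule guessing_bound[OF p2 N])
    show "0 \<le> J i u v" for i u v unfolding J using Z0 by (simp add: sum_nonneg)
    show "(\<Sum>v<p. J i u v) = 1 / real p" if "i < N" "u < p" for i u
    proof -
      have "(\<Sum>v<p. J i u v) = 1 / real p ^ N * (\<Sum>xv\<in>{xv \<in> vecs N p. xv i = u}. \<Sum>v<p. Z i xv v)"
        unfolding J sum_distrib_left[symmetric] by (subst sum.swap) simp
      also have "\<dots> = 1 / real p ^ N * real (card {xv \<in> vecs N p. xv i = u})" by (simp add: Zsum)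
      also have "\<dots> = 1 / real p"
        using card_vecs_fixed[OF that, THEN arg_cong[where f = real]] p0 by (simp add: field_simps)
      finally show ?thesis .
    qed
    \<comment> \<open>Grouping the input vectors by their \<open>i\<close>-th entry turns the
      diagonal sum into the average over all inputs of the success probability, which is at least
      \<open>S\<close> for each.\<close>
    show "S \<le> (\<Sum>u<p. J i u u)" if i: "i < N" for i
    proof -
      have "(\<Sum>u<p. J i u u) = 1 / real p ^ N * (\<Sum>u<p. \<Sum>xv\<in>{xv \<in> vecs N p. xv i = u}. Z i xv (xv i))"
        unfolding J sum_distrib_left[symmetric] by simp
      also have "(\<Sum>u<p. \<Sum>xv\<in>{xv \<in> vecs N p. xv i = u}. Z i xv (xv i)) = (\<Sum>xv\<in>vecs N p. Z i xv (xv i))"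
        by (rule sum.group) (use i in \<open>auto simp: vecs_def finite_PiE\<close>)
      finally have eq: "(\<Sum>u<p. J i u u) = 1 / real p ^ N * (\<Sum>xv\<in>vecs N p. Z i xv (xv i))" .
      have "real p ^ N * S = (\<Sum>xv\<in>vecs N p. S)" by (simp add: card_vecs)
      also have "\<dots> \<le> (\<Sum>xv\<in>vecs N p. Z i xv (xv i))" by (rule sum_mono) (rule ZS[OF i])
      finally show ?thesis unfolding eq using p0 by (simp add: field_simps)
    qed
    show "(\<Sum>i<N. mutual_info p (J i)) \<le> log 2 (real p)"
      unfolding J_def using IC N by (simp add: info_causality_def)
  qed
  then show ?thesis unfolding M_def[symmetric] S by simp
qed

theorem theorem5:
  fixes p :: nat and f :: "nat \<Rightarrow> nat \<Rightarrow> nat"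
    and P :: "nat \<Rightarrow> nat \<Rightarrow> nat \<Rightarrow> nat \<Rightarrow> real"
  assumes "prime p"
    and "\<forall>x y. x < p \<longrightarrow> y < p \<longrightarrow> f x y < p"
    and "\<not> additively_separable p f"
    and "Delta p f > 2"
    and "is_box p P" and "no_signalling p P"
    and "info_causality p P"
  shows "(\<forall>N c. 1 \<le> N \<and> N \<le> p \<and> c < p \<longrightarrow>
            (let L = (N - 1) * 2 ^ (Delta p f - 2);
                 S = bound_lhs p (nu p P f) L c
             in S \<in> \<real> \<and> Re S \<le> Tp_inv p ((real N - 1) / real N * log 2 (real p))))
       \<and> (\<forall>n c. 1 \<le> n \<and> c < p \<longrightarrow>
            (let N = p ^ n; L = n * (p - 1) * 2 ^ (Delta p f - 2);
                 S = bound_lhs p (nu p P f) L c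
             in S \<in> \<real> \<and> Re S \<le> Tp_inv p ((real N - 1) / real N * log 2 (real p))))"
proof -
  have p1: "p \<ge> 1" using assms(1) prime_ge_1_nat by blast
  note bound = xcode_bound[OF assms(1,2,4,5,7)]
  show ?thesis
    unfolding Let_def
  proof (intro conjI allI impI; elim conjE)
    fix N c :: nat assume N: "1 \<le> N" and c: "c < p"
    from bound[OF N c xcode_exists_linear[OF N]] show "bound_lhs p (nu p P f) ((N - 1) * 2 ^ (Delta p f - 2)) c \<in> \<real>"
      "Re (bound_lhs p (nu p P f) ((N - 1) * 2 ^ (Delta p f - 2)) c)
        \<le> Tp_inv p ((real N - 1) / real N * log 2 (real p))" by blast+
  next
    fix n c assume c: "c < p"
    have "p ^ n \<ge> 1" using p1 by simp
    from bound[OF this c xcode_exists_power[OF p1]] show "bound_lhs p (nu p P f) (n * (p - 1) * 2 ^ (Delta p f - 2)) c \<in> \<real>"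
      "Re (bound_lhs p (nu p P f) (n * (p - 1) * 2 ^ (Delta p f - 2)) c)
        \<le> Tp_inv p ((real (p ^ n) - 1) / real (p ^ n) * log 2 (real p))" by blast+
  qed
qed

end
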